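(* Let $0<R\le\infty$ and let $(\mathcal{R}_1,\mu_1)$ and $(\mathcal{R}_2,\mu_2)$ be non-atomic $\sigma$-finite measure spaces with $\mu_1(\mathcal{R}_1)=\mu_2(\mathcal{R}_2)=R$. Let $\varphi,\psi$ be quasiconcave functions on $[0,R)$ satisfying the $B$-condition, let $1\le p<\infty$ and let $\phi_1,\phi_2$ be nontrivial weights on $(0,R)$ (with respect to $p$). If $\varphi$ is not continuous, assume in addition that $\lim_{t\to0^+}t^p\int_t^R s^{-p}\phi_1(s)\,ds>0$ and $\int_0^R\varphi^{-p}(s)\phi_2(s)\,ds<\infty$. Suppose that $$M_\varphi(\mathcal{R}_i)\cap M_\psi(\mathcal{R}_i)\subset \Gamma^p_{\phi_i}(\mathcal{R}_i)\subset M_\varphi(\mathcal{R}_i)+M_\psi(\mathcal{R}_i),\quad i=1,2,$$ and that $T$ is a quasilinear operator with $T\colon M_\varphi(\mathcal{R}_1)\to M_\varphi(\mathcal{R}_2)$ and $T\colon M_\psi(\mathcal{R}_1)\to M_\psi(\mathcal{R}_2)$ bounded. If $$\sup_{0<t<R}\frac{\psi^p(t)\int_0^t\psi^{-p}(s)\phi_2(s)\,ds+\varphi^p(t)\int_t^R\varphi^{-p}(s)\phi_2(s)\,ds}{\int_0^t\phi_1(s)\,ds+t^p\int_t^R s^{-p}\phi_1(s)\,ds}<\infty,$$ then $T\colon\Gamma^p_{\phi_1}(\mathcal{R}_1)\to\Gamma^p_{\phi_2}(\mathcal{R}_2)$ is bounded.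
   Context: For a measure space $(\mathcal{R},\mu)$, $f^*(t)=\inf\{\lambda>0: \mu(\{x:|f(x)|>\lambda\})\le t\}$ and $f^{**}(t)=\frac1t\int_0^t f^*(s)\,ds$ for measurable a.e. finite $f$. A function $\varphi\colon[0,R)\to[0,\infty)$ is quasiconcave if $\varphi(t)=0$ iff $t=0$, $\varphi$ is non-decreasing, and $\varphi(t)/t$ is non-increasing on $(0,R)$. It satisfies the $B$-condition if there is $C>0$ with $\frac1t\int_0^t \frac{ds}{\varphi(s)}\le \frac{C}{\varphi(t)}$ for all $t\in(0,R)$. $M_\varphi(\mathcal{R},\mu)$ is the set of measurable a.e. finite $f$ with $\|f\|_{M_\varphi}=\sup_{0<s<R}\varphi(s)f^{**}(s)<\infty$. A weight is a positive locally integrable function $\phi$ on $(0,R)$; it is nontrivial (for exponent $p$) if $\int_1^\infty s^{-p}\phi(s)\,ds<\infty$ when $R=\infty$, and $\int_0^R s^{-p}\phi(s)\,ds=\infty$ when $R<\infty$. The Lorentz gamma space $\Gamma^p_\phi(\mathcal{R},\mu)$ consists of $f$ with $\|f\|_{\Gamma^p_\phi}=\left(\int_0^R[f^{**}(t)]^p\phi(t)\,dt\right)^{1/p}<\infty$. An operator $T$ is quasilinear if $|T(\lambda f)|=|\lambda||Tf|$ and $|T(f+g)|\le C(|Tf|+|Tg|)$ a.e. for some constant $C$. "$T\colon X\to Y$" means $T$ maps $X$ boundedly into $Y$. *)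

theory Defs
  imports "HOL-Analysis.Analysis"
begin

definition Ioo0 :: "ennreal \<Rightarrow> real set" where
  "Ioo0 R = {t. 0 < t \<and> ennreal t < R}"

definition Ico0 :: "ennreal \<Rightarrow> real set" where
  "Ico0 R = {t. 0 \<le> t \<and> ennreal t < R}"

definition IooR :: "real \<Rightarrow> ennreal \<Rightarrow> real set" where
  "IooR t R = {s. t < s \<and> ennreal s < R}"

definition nonatomic :: "'a measure \<Rightarrow> bool" where
  "nonatomic M \<longleftrightarrow> (\<forall>A\<in>sets M. 0 < emeasure M A \<longrightarrow>
      (\<exists>B\<in>sets M. B \<subseteq> A \<and> 0 < emeasure M B \<and> emeasure M B < emeasure M A))"

definition drearr :: "'a measure \<Rightarrow> ('a \<Rightarrow> real) \<Rightarrow> real \<Rightarrow> ennreal" where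
  "drearr M f t = Inf {l::ennreal. 0 < l \<and>
      emeasure M {x\<in>space M. l < ennreal \<bar>f x\<bar>} \<le> ennreal t}"

definition maxrearr :: "'a measure \<Rightarrow> ('a \<Rightarrow> real) \<Rightarrow> real \<Rightarrow> ennreal" where
  "maxrearr M f t = (\<integral>\<^sup>+ s\<in>{0<..<t}. drearr M f s \<partial>lborel) / ennreal t"

definition quasiconcave :: "ennreal \<Rightarrow> (real \<Rightarrow> real) \<Rightarrow> bool" where
  "quasiconcave R \<phi> \<longleftrightarrow>
     (\<forall>t\<in>Ico0 R. 0 \<le> \<phi> t) \<and>
     (\<forall>t\<in>Ico0 R. \<phi> t = 0 \<longleftrightarrow> t = 0) \<and>
     mono_on (Ico0 R) \<phi> \<and>
     (\<forall>s\<in>Ioo0 R. \<forall>t\<in>Ioo0 R. s \<le> t \<longrightarrow> \<phi> t / t \<le> \<phi> s / s)"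

definition B_condition :: "ennreal \<Rightarrow> (real \<Rightarrow> real) \<Rightarrow> bool" where
  "B_condition R \<phi> \<longleftrightarrow> (\<exists>C>0. \<forall>t\<in>Ioo0 R.
     (\<integral>\<^sup>+ s\<in>{0<..<t}. ennreal (1 / \<phi> s) \<partial>lborel) / ennreal t \<le> ennreal (C / \<phi> t))"

definition M_norm :: "ennreal \<Rightarrow> (real \<Rightarrow> real) \<Rightarrow> 'a measure \<Rightarrow> ('a \<Rightarrow> real) \<Rightarrow> ennreal" where
  "M_norm R \<phi> M f = (SUP s\<in>Ioo0 R. ennreal (\<phi> s) * maxrearr M f s)"

definition M_space :: "ennreal \<Rightarrow> (real \<Rightarrow> real) \<Rightarrow> 'a measure \<Rightarrow> ('a \<Rightarrow> real) set" where
  "M_space R \<phi> M = {f. f \<in> borel_measurable M \<and> M_norm R \<phi> M f < \<infinity> }"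

definition weight :: "ennreal \<Rightarrow> (real \<Rightarrow> real) \<Rightarrow> bool" where
  "weight R w \<longleftrightarrow> (\<forall>t\<in>Ioo0 R. 0 < w t) \<and>
     (\<forall>a b. 0 < a \<longrightarrow> a \<le> b \<longrightarrow> ennreal b < R \<longrightarrow> set_integrable lborel {a..b} w)"

definition nontrivial_weight :: "ennreal \<Rightarrow> real \<Rightarrow> (real \<Rightarrow> real) \<Rightarrow> bool" where
  "nontrivial_weight R p w \<longleftrightarrow> weight R w \<and>
     (R = \<infinity> \<longrightarrow> (\<integral>\<^sup>+ s\<in>{1<..}. ennreal (s powr (-p) * w s) \<partial>lborel) < \<infinity>) \<and>
     (R < \<infinity> \<longrightarrow> (\<integral>\<^sup>+ s\<in>Ioo0 R. ennreal (s powr (-p) * w s) \<partial>lborel) = \<infinity>)"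

definition Gamma_norm :: "ennreal \<Rightarrow> real \<Rightarrow> (real \<Rightarrow> real) \<Rightarrow> 'a measure \<Rightarrow> ('a \<Rightarrow> real) \<Rightarrow> ennreal" where
  "Gamma_norm R p w M f =
     (let I = (\<integral>\<^sup>+ t\<in>Ioo0 R. (if maxrearr M f t = \<infinity> then \<infinity>
                   else ennreal (enn2real (maxrearr M f t) powr p)) * ennreal (w t) \<partial>lborel)
      in if I = \<infinity> then \<infinity> else ennreal (enn2real I powr (1 / p)))"

definition Gamma_space :: "ennreal \<Rightarrow> real \<Rightarrow> (real \<Rightarrow> real) \<Rightarrow> 'a measure \<Rightarrow> ('a \<Rightarrow> real) set" where
  "Gamma_space R p w M = {f. f \<in> borel_measurable M \<and> Gamma_norm R p w M f < \<infinity> }"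

definition fun_set_plus :: "('a \<Rightarrow> real) set \<Rightarrow> ('a \<Rightarrow> real) set \<Rightarrow> ('a \<Rightarrow> real) set" where
  "fun_set_plus X Y = {f. \<exists>g\<in>X. \<exists>h\<in>Y. f = (\<lambda>x. g x + h x)}"

definition quasilinear :: "'a measure \<Rightarrow> 'b measure \<Rightarrow> ('a \<Rightarrow> real) set
    \<Rightarrow> (('a \<Rightarrow> real) \<Rightarrow> ('b \<Rightarrow> real)) \<Rightarrow> bool" where
  "quasilinear M1 M2 D T \<longleftrightarrow>
     (\<forall>f\<in>D. T f \<in> borel_measurable M2) \<and>
     (\<forall>f\<in>D. \<forall>c::real. AE x in M2. \<bar>T (\<lambda>y. c * f y) x\<bar> = \<bar>c\<bar> * \<bar>T f x\<bar>) \<and>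
     (\<exists>C. \<forall>f\<in>D. \<forall>g\<in>D. AE x in M2. \<bar>T (\<lambda>y. f y + g y) x\<bar> \<le> C * (\<bar>T f x\<bar> + \<bar>T g x\<bar>))"

definition bounded_op :: "('a \<Rightarrow> real) set \<Rightarrow> (('a \<Rightarrow> real) \<Rightarrow> ennreal)
    \<Rightarrow> ('b \<Rightarrow> real) set \<Rightarrow> (('b \<Rightarrow> real) \<Rightarrow> ennreal)
    \<Rightarrow> (('a \<Rightarrow> real) \<Rightarrow> ('b \<Rightarrow> real)) \<Rightarrow> bool" where
  "bounded_op X nX Y nY T \<longleftrightarrow> (\<exists>C::real. 0 \<le> C \<and>
     (\<forall>f\<in>X. T f \<in> Y \<and> nY (T f) \<le> ennreal C * nX f))"

end

theory Submission
  imports Defs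
begin

text \<open>
  Fix \<open>t\<close> and let \<open>N\<close> satisfy \<open>f\<^sup>*\<^sup>* \<le> N max (\<phi>(t)/\<phi>) (\<psi>(t)/\<psi>)\<close>. Cutting \<open>f\<close> along its values
  splits it into a part of \<open>M\<^sub>\<phi>\<close>-norm at most \<open>C N \<phi>(t)\<close> and a part of \<open>M\<^sub>\<psi>\<close>-norm at most
  \<open>C N \<psi>(t)\<close>, so that \<open>(T f)\<^sup>*\<^sup>*(t) \<le> C' N\<close>.

  Put \<open>F(t) = \<integral>\<^sub>0\<^sup>t f\<^sup>*\<close>. Up to constants \<open>F\<^sup>p(t)\<close> equals \<open>\<integral>\<^sub>0\<^sup>t F\<^sup>p\<^sup>-\<^sup>1 f\<^sup>* = \<integral>\<^sub>0\<^sup>t k(s) s\<^sup>p\<^sup>-\<^sup>1 ds\<close>, where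
  \<open>k = (f\<^sup>*\<^sup>*)\<^sup>p\<^sup>-\<^sup>1 f\<^sup>*\<close> is non-increasing. By the layer-cake formula \<open>(f\<^sup>*\<^sup>*)\<^sup>p\<close> is therefore comparable to a
  superposition of the functions \<open>min(1, a/t)\<^sup>p\<close>. Quasiconcavity gives
  \<open>min(1, a/s) \<le> max (\<phi>(t)/\<phi>(s)) (\<psi>(t)/\<psi>(s)) \<cdot> min (\<phi>(a)/\<phi>(t)) (\<psi>(a)/\<psi>(t))\<close>, which bounds \<open>N\<^sup>p\<close> by the
  corresponding superposition of \<open>min (\<phi>(a)/\<phi>(t)) (\<psi>(a)/\<psi>(t))\<^sup>p\<close>. By Fubini it remains to compare
  the two families of test functions for a single \<open>a\<close>, and that comparison is the supremum condition.
\<close>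

subsection \<open>Rearrangements\<close>

lemma borel_measurable_antimono_ennreal:
  fixes g :: "real \<Rightarrow> ennreal"
  assumes "antimono g"
  shows "g \<in> borel_measurable borel"
proof (rule borel_measurableI_greater)
  fix y
  have "is_interval {x. y < g x}"
    unfolding is_interval_1 using assms by (auto dest: antimonoD intro: less_le_trans)
  then show "{x \<in> space borel. y < g x} \<in> sets borel"
    by (simp add: real_interval_borel_measurable)
qed

text \<open>Averages over \<open>(0,t)\<close> of a non-increasing function decrease in
  \<open>t\<close>: the substitution \<open>t / s * x\<close> is a dilation by a factor at least 1
  and can only lower the integrand.\<close>

lemma nn_integral_antimono_scale:
  fixes g :: "real \<Rightarrow> ennreal"
  assumes g: "antimono_on {0<..} g" "g \<in> borel_measurable borel" and st: "0 < s" "s \<le> t"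
  shows "(\<integral>\<^sup>+ x\<in>{0<..<t}. g x \<partial>lborel) \<le> ennreal (t / s) * (\<integral>\<^sup>+ x\<in>{0<..<s}. g x \<partial>lborel)"
proof -
  have [measurable]: "g \<in> borel_measurable borel" by (rule g)
  have "(\<integral>\<^sup>+ x\<in>{0<..<t}. g x \<partial>lborel)
      = ennreal (t / s) * (\<integral>\<^sup>+ x. g (t / s * x) * indicator {0<..<t} (t / s * x) \<partial>lborel)"
    using st by (subst nn_integral_real_affine[where c = "t / s" and t = 0]) auto
  also have "\<dots> \<le> ennreal (t / s) * (\<integral>\<^sup>+ x\<in>{0<..<s}. g x \<partial>lborel)"
  proof (intro mult_left_mono nn_integral_mono)
    fix x
    have "g (t / s * x) \<le> g x" if "0 < x"
    proof (rule monotone_onD[OF g(1)])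
      have "1 * x \<le> t / s * x" using that st by (intro mult_right_mono) auto
      then show "x \<le> t / s * x" by simp
    qed (use that st in auto)
    then show "g (t / s * x) * indicator {0<..<t} (t / s * x) \<le> g x * indicator {0<..<s} x"
      using st by (auto simp: indicator_def zero_less_mult_iff field_simps)
  qed auto
  finally show ?thesis .
qed

lemma antimono_drearr: "antimono (drearr M f)"
proof (rule antimonoI)
  fix s t :: real assume "s \<le> t"
  then have "ennreal s \<le> ennreal t" by (rule ennreal_leI)
  then show "drearr M f t \<le> drearr M f s"
    unfolding drearr_def by (intro Inf_superset_mono) (auto intro: order_trans)
qed

lemma borel_measurable_drearr [measurable]: "drearr M f \<in> borel_measurable borel"
  by (rule borel_measurable_antimono_ennreal[OF antimono_drearr])

text \<open>Testing levels strictly above \<open>l\<close> suffices because the order is dense; this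
  also covers \<open>l = 0\<close>, a level that the infimum in \<open>drearr\<close> leaves
  out.\<close>

lemma drearr_leI:
  assumes "\<And>l'. l < l' \<Longrightarrow> emeasure M {x\<in>space M. l' < ennreal \<bar>f x\<bar>} \<le> ennreal t"
  shows "drearr M f t \<le> l"
proof (rule dense_ge)
  fix l' assume "l < l'"
  then show "drearr M f t \<le> l'"
    unfolding drearr_def using assms[of l'] by (intro Inf_lower) (auto intro: le_less_trans)
qed

lemma emeasure_le_if_drearr_less:
  assumes [measurable]: "f \<in> borel_measurable M" and "drearr M f t < l"
  shows "emeasure M {x\<in>space M. l < ennreal \<bar>f x\<bar>} \<le> ennreal t"
proof -
  obtain l' where "l' < l" and *: "emeasure M {x\<in>space M. l' < ennreal \<bar>f x\<bar>} \<le> ennreal t"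
    using assms(2) unfolding drearr_def Inf_less_iff by auto
  then have "emeasure M {x\<in>space M. l < ennreal \<bar>f x\<bar>} \<le> emeasure M {x\<in>space M. l' < ennreal \<bar>f x\<bar>}"
    by (intro emeasure_mono) auto
  with * show ?thesis by order
qed

text \<open>Almost everywhere, where \<open>|f|\<close> exceeds
  \<open>C * (\<alpha> + \<beta>)\<close>, either \<open>|g|\<close> exceeds \<alpha> or
  \<open>|h|\<close> exceeds \<beta>; each of these two sets is allowed the measure
  \<open>s / 2\<close>.\<close>

lemma drearr_quasi_subadditive:
  assumes [measurable]: "f \<in> borel_measurable M" "g \<in> borel_measurable M" "h \<in> borel_measurable M"
    and C: "0 < C" and le: "AE x in M. \<bar>f x\<bar> \<le> C * (\<bar>g x\<bar> + \<bar>h x\<bar>)" and s: "0 < s"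
  shows "drearr M f s \<le> ennreal C * (drearr M g (s / 2) + drearr M h (s / 2))"
proof (cases "drearr M g (s / 2) + drearr M h (s / 2) = \<infinity>")
  case True
  then show ?thesis using C by (simp only: True) (simp add: ennreal_mult_top)
next
  case False
  then obtain a b where ab: "0 \<le> a" "0 \<le> b" "drearr M g (s / 2) = ennreal a" "drearr M h (s / 2) = ennreal b"
    by (cases "drearr M g (s / 2)"; cases "drearr M h (s / 2)") auto
  have "drearr M f s \<le> ennreal (C * (a + b))"
  proof (rule drearr_leI)
    fix l' assume l': "ennreal (C * (a + b)) < l'"
    show "emeasure M {x \<in> space M. l' < ennreal \<bar>f x\<bar>} \<le> ennreal s"
    proof (cases l')
      case (real r)
      \<comment> \<open>Half of the excess of \<open>r / C\<close> over \<open>a + b\<close>: the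
        levels \<open>a + e\<close> and \<open>b + e\<close> then lie strictly above the two
        rearrangements, while \<open>C\<close> times their sum is still \<open>r\<close>.\<close>
      define e where "e = (r / C - (a + b)) / 2"
      have Cab: "0 \<le> C * (a + b)" using C ab by simp
      have "C * (a + b) < r" using l' real Cab by (simp add: ennreal_less_iff)
      then have e: "0 < e" using C by (simp add: e_def field_simps)
      have r: "r = C * ((a + e) + (b + e))" using C by (simp add: e_def field_simps)
      have "emeasure M {x \<in> space M. l' < ennreal \<bar>f x\<bar>}
          \<le> emeasure M ({x \<in> space M. ennreal (a + e) < ennreal \<bar>g x\<bar>} \<union> {x \<in> space M. ennreal (b + e) < ennreal \<bar>h x\<bar>})"
      proof (rule emeasure_mono_AE)
        show "AE x in M. x \<in> {x \<in> space M. l' < ennreal \<bar>f x\<bar>} \<longrightarrow>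
          x \<in> {x \<in> space M. ennreal (a + e) < ennreal \<bar>g x\<bar>} \<union> {x \<in> space M. ennreal (b + e) < ennreal \<bar>h x\<bar>}"
          using le
        proof eventually_elim
          case (elim x)
          have "\<not> (\<bar>g x\<bar> \<le> a + e \<and> \<bar>h x\<bar> \<le> b + e)" if "r < \<bar>f x\<bar>"
          proof
            assume "\<bar>g x\<bar> \<le> a + e \<and> \<bar>h x\<bar> \<le> b + e"
            then have "C * (\<bar>g x\<bar> + \<bar>h x\<bar>) \<le> r" unfolding r using C by (intro mult_left_mono) auto
            with elim that show False by simp
          qed
          then show ?case using real ab e by (auto simp: ennreal_less_iff simp del: ennreal_plus)
        qed
      qed auto
      also have "\<dots> \<le> emeasure M {x \<in> space M. ennreal (a + e) < ennreal \<bar>g x\<bar>}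
          + emeasure M {x \<in> space M. ennreal (b + e) < ennreal \<bar>h x\<bar>}"
        by (intro emeasure_subadditive) auto
      also have "\<dots> \<le> ennreal (s / 2) + ennreal (s / 2)"
        using ab e by (intro add_mono emeasure_le_if_drearr_less) (auto simp: ennreal_less_iff)
      also have "\<dots> = ennreal s" using s by (simp flip: ennreal_plus)
      finally show ?thesis .
    qed simp
  qed
  then show ?thesis using ab C by (simp add: ennreal_mult flip: ennreal_plus)
qed

text \<open>On \<open>(0,t)\<close> a non-increasing function is at least its value at
  \<open>t\<close>, hence so is its average.\<close>

lemma drearr_le_maxrearr:
  assumes t: "0 < t"
  shows "drearr M f t \<le> maxrearr M f t"
proof -
  have "drearr M f t * ennreal t = (\<integral>\<^sup>+ s\<in>{0<..<t}. drearr M f t \<partial>lborel)"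
    using t by (simp add: nn_integral_cmult_indicator)
  also have "\<dots> \<le> (\<integral>\<^sup>+ s\<in>{0<..<t}. drearr M f s \<partial>lborel)"
    by (intro nn_integral_mono) (auto simp: indicator_def intro: antimonoD[OF antimono_drearr])
  finally have "drearr M f t * ennreal t / ennreal t \<le> maxrearr M f t"
    unfolding maxrearr_def by (rule divide_right_mono_ennreal)
  moreover have "drearr M f t * ennreal t / ennreal t = drearr M f t"
    using t by (simp add: ennreal_divide_times[symmetric] mult_divide_eq_ennreal)
  ultimately show ?thesis by simp
qed

lemma nn_integral_drearr_eq:
  assumes "0 < t"
  shows "(\<integral>\<^sup>+ s\<in>{0<..<t}. drearr M f s \<partial>lborel) = ennreal t * maxrearr M f t"
  unfolding maxrearr_def using assms
  by (metis ennreal_neq_top ennreal_times_divide ennreal_eq_0_iff mult.commute mult_divide_eq_ennreal not_less)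

text \<open>The bound for \<open>drearr\<close> is integrated over \<open>(0,t)\<close>; the halved
  argument costs the factor 2.\<close>

lemma maxrearr_quasi_subadditive:
  assumes [measurable]: "f \<in> borel_measurable M" "g \<in> borel_measurable M" "h \<in> borel_measurable M"
    and C: "0 < C" and le: "AE x in M. \<bar>f x\<bar> \<le> C * (\<bar>g x\<bar> + \<bar>h x\<bar>)" and t: "0 < t"
  shows "maxrearr M f t \<le> ennreal (2 * C) * (maxrearr M g t + maxrearr M h t)"
proof -
  \<comment> \<open>Substituting \<open>2 * s\<close> turns the domain into
    \<open>(0, t / 2)\<close>, which is then enlarged to \<open>(0,t)\<close>.\<close>
  have half: "(\<integral>\<^sup>+ s. drearr M u (s / 2) * indicator {0<..<t} s \<partial>lborel) \<le> 2 * (\<integral>\<^sup>+ s\<in>{0<..<t}. drearr M u s \<partial>lborel)"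
    for u :: "'a \<Rightarrow> real"
  proof -
    have "(\<integral>\<^sup>+ s. drearr M u (s / 2) * indicator {0<..<t} s \<partial>lborel)
        = ennreal 2 * (\<integral>\<^sup>+ s. drearr M u s * indicator {0<..<t} (2 * s) \<partial>lborel)"
      by (subst nn_integral_real_affine[where c = 2 and t = 0]) auto
    also have "\<dots> \<le> ennreal 2 * (\<integral>\<^sup>+ s\<in>{0<..<t}. drearr M u s \<partial>lborel)"
      by (intro mult_left_mono nn_integral_mono) (auto simp: indicator_def)
    finally show ?thesis by simp
  qed
  have "(\<integral>\<^sup>+ s\<in>{0<..<t}. drearr M f s \<partial>lborel)
      \<le> (\<integral>\<^sup>+ s. ennreal C * (drearr M g (s / 2) * indicator {0<..<t} s + drearr M h (s / 2) * indicator {0<..<t} s) \<partial>lborel)"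
    using drearr_quasi_subadditive[OF assms(1-5)]
    by (intro nn_integral_mono) (auto simp: indicator_def)
  also have "\<dots> = ennreal C * ((\<integral>\<^sup>+ s. drearr M g (s / 2) * indicator {0<..<t} s \<partial>lborel)
      + (\<integral>\<^sup>+ s. drearr M h (s / 2) * indicator {0<..<t} s \<partial>lborel))"
    by (simp add: nn_integral_cmult nn_integral_add)
  also have "\<dots> \<le> ennreal C * (2 * (\<integral>\<^sup>+ s\<in>{0<..<t}. drearr M g s \<partial>lborel) + 2 * (\<integral>\<^sup>+ s\<in>{0<..<t}. drearr M h s \<partial>lborel))"
    by (intro mult_left_mono add_mono half) auto
  also have "\<dots> = ennreal (2 * C) * (\<integral>\<^sup>+ s\<in>{0<..<t}. drearr M g s \<partial>lborel) + ennreal (2 * C) * (\<integral>\<^sup>+ s\<in>{0<..<t}. drearr M h s \<partial>lborel)"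
    using C by (simp add: ennreal_mult distrib_left mult_ac)
  finally have "maxrearr M f t \<le> (ennreal (2 * C) * (\<integral>\<^sup>+ s\<in>{0<..<t}. drearr M g s \<partial>lborel)
      + ennreal (2 * C) * (\<integral>\<^sup>+ s\<in>{0<..<t}. drearr M h s \<partial>lborel)) / ennreal t"
    unfolding maxrearr_def[of M f] by (rule divide_right_mono_ennreal)
  then show ?thesis
    unfolding maxrearr_def by (simp add: add_divide_distrib_ennreal ennreal_times_divide distrib_left)
qed

subsection \<open>Decomposition and the pointwise bound\<close>

lemma quasiconcave_pos: "quasiconcave R \<phi> \<Longrightarrow> t \<in> Ioo0 R \<Longrightarrow> 0 < \<phi> t"
  unfolding quasiconcave_def Ioo0_def Ico0_def by (smt (verit) mem_Collect_eq)

lemma quasiconcave_mono: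
  "quasiconcave R \<phi> \<Longrightarrow> s \<in> Ioo0 R \<Longrightarrow> t \<in> Ioo0 R \<Longrightarrow> s \<le> t \<Longrightarrow> \<phi> s \<le> \<phi> t"
  unfolding quasiconcave_def Ioo0_def Ico0_def by (auto elim!: mono_onD)

lemma Ioo0_downward: "t \<in> Ioo0 R \<Longrightarrow> 0 < s \<Longrightarrow> s \<le> t \<Longrightarrow> s \<in> Ioo0 R"
  unfolding Ioo0_def by (auto intro: le_less_trans[OF ennreal_leI])

text \<open>A value \<open>v\<close> of \<open>f\<close> is admissible for \<open>u\<close> when placing it on the
  whole set \<open>{v \<le> |f|}\<close> still keeps the rearrangement below \<open>u\<close>.\<close>

definition admissible :: "'a measure \<Rightarrow> ('a \<Rightarrow> real) \<Rightarrow> ennreal \<Rightarrow> (real \<Rightarrow> real) \<Rightarrow> real \<Rightarrow> bool" where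
  "admissible M f R u v \<longleftrightarrow>
     (\<forall>s\<in>Ioo0 R. ennreal s < emeasure M {x\<in>space M. v \<le> \<bar>f x\<bar>} \<longrightarrow> v \<le> u s)"

text \<open>If \<open>v\<close> failed for both functions, then at the larger of the two witnesses,
  called \<open>s\<close>, both \<open>u1 s\<close> and \<open>u2 s\<close> would be below
  \<open>v\<close> while \<open>{v \<le> |f|}\<close> has measure above \<open>s\<close>. A level
  strictly between them and \<open>v\<close> contradicts the bound on
  \<open>drearr M f s\<close>.\<close>

lemma admissible_cases:
  assumes [measurable]: "f \<in> borel_measurable M"
    and anti: "\<And>s t. s \<in> Ioo0 R \<Longrightarrow> t \<in> Ioo0 R \<Longrightarrow> s \<le> t \<Longrightarrow> u1 t \<le> u1 s \<and> u2 t \<le> u2 s"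
    and nn: "\<And>s. s \<in> Ioo0 R \<Longrightarrow> 0 \<le> u1 s"
    and bound: "\<And>s. s \<in> Ioo0 R \<Longrightarrow> drearr M f s \<le> ennreal (max (u1 s) (u2 s))"
  shows "admissible M f R u1 v \<or> admissible M f R u2 v"
proof (rule ccontr)
  assume "\<not> ?thesis"
  then obtain s1 s2 where s: "s1 \<in> Ioo0 R" "s2 \<in> Ioo0 R" "u1 s1 < v" "u2 s2 < v"
    "ennreal s1 < emeasure M {x\<in>space M. v \<le> \<bar>f x\<bar>}" "ennreal s2 < emeasure M {x\<in>space M. v \<le> \<bar>f x\<bar>}"
    unfolding admissible_def by (auto simp: not_le)
  define s where "s = max s1 s2"
  have sR: "s \<in> Ioo0 R" "ennreal s < emeasure M {x\<in>space M. v \<le> \<bar>f x\<bar>}"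
    using s by (auto simp: s_def max_def)
  have "max (u1 s) (u2 s) < v"
    using s anti[of s1 s] anti[of s2 s] sR by (force simp: s_def)
  moreover define l where "l = (max (u1 s) (u2 s) + v) / 2"
  ultimately have l: "max (u1 s) (u2 s) < l" "l < v" by auto
  have "0 \<le> max (u1 s) (u2 s)" using nn[OF sR(1)] by simp
  then have "drearr M f s < ennreal l"
    using bound[OF sR(1)] l by (auto simp: ennreal_less_iff intro: le_less_trans)
  then have "emeasure M {x\<in>space M. ennreal l < ennreal \<bar>f x\<bar>} \<le> ennreal s"
    by (intro emeasure_le_if_drearr_less) auto
  moreover have "emeasure M {x\<in>space M. v \<le> \<bar>f x\<bar>} \<le> emeasure M {x\<in>space M. ennreal l < ennreal \<bar>f x\<bar>}"
    using l \<open>0 \<le> max _ _\<close> by (intro emeasure_mono) (auto simp: ennreal_less_iff)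
  ultimately show False using sR by order
qed

text \<open>Admissibility of \<open>v\<close> amounts to \<open>v \<le> g v\<close>, where
  \<open>g v\<close> is the infimum of \<open>u\<close> over the points below the measure of
  \<open>{v \<le> |f|}\<close>. These points become fewer as \<open>v\<close> grows, so
  \<open>g\<close> is non-decreasing and hence Borel.\<close>

lemma admissible_set_borel:
  assumes [measurable]: "f \<in> borel_measurable M"
  shows "{v. admissible M f R u v} \<in> sets borel"
proof -
  \<comment> \<open>In \<open>ereal\<close> the infimum over the empty set is infinite, which is the
    right value when, for instance, the level set is null.\<close>
  define g where "g v = (INF s\<in>{s\<in>Ioo0 R. ennreal s < emeasure M {x\<in>space M. v \<le> \<bar>f x\<bar>}}. ereal (u s))" for v
  have "mono g"
  proof (rule monoI)
    fix v v' :: real assume "v \<le> v'"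
    then have "emeasure M {x\<in>space M. v' \<le> \<bar>f x\<bar>} \<le> emeasure M {x\<in>space M. v \<le> \<bar>f x\<bar>}"
      by (intro emeasure_mono) auto
    then show "g v \<le> g v'" unfolding g_def by (intro INF_superset_mono) (auto intro: less_le_trans)
  qed
  have gm [measurable]: "g \<in> borel_measurable borel"
  proof (rule borel_measurableI_greater)
    fix y
    have "is_interval {x. y < g x}"
      unfolding is_interval_1 using \<open>mono g\<close> by (auto dest: monoD intro: less_le_trans)
    then show "{x \<in> space borel. y < g x} \<in> sets borel"
      by (simp add: real_interval_borel_measurable)
  qed
  have "admissible M f R u v \<longleftrightarrow> ereal v \<le> g v" for v
    by (auto simp: admissible_def g_def le_INF_iff)
  moreover have "{v \<in> space borel. ereal v \<le> g v} \<in> sets borel" by measurable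
  ultimately show ?thesis by simp
qed

text \<open>A value of \<open>|g|\<close> above \<open>u s\<close> is an admissible value
  \<open>v\<close> of \<open>|f|\<close>, so \<open>{v \<le> |f|}\<close> has measure at most
  \<open>s\<close>. These sets are nested in \<open>v\<close>, and continuity of the measure from
  below bounds their union.\<close>

lemma drearr_admissible_le:
  assumes [measurable]: "f \<in> borel_measurable M" "g \<in> borel_measurable M"
    and g: "\<And>x. x \<in> space M \<Longrightarrow> g x = 0 \<or> g x = f x \<and> admissible M f R u \<bar>f x\<bar>"
    and s: "s \<in> Ioo0 R" and u: "0 \<le> u s"
  shows "drearr M g s \<le> ennreal (u s)"
proof (rule drearr_leI)
  fix l' assume l': "ennreal (u s) < l'"
  show "emeasure M {x \<in> space M. l' < ennreal \<bar>g x\<bar>} \<le> ennreal s"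
  proof (cases l')
    case (real l)
    with l' u have l: "u s < l" "0 \<le> l" by (auto simp: ennreal_less_iff)
    let ?W = "{v. l < v \<and> emeasure M {x\<in>space M. v \<le> \<bar>f x\<bar>} \<le> ennreal s}"
    have sub: "{x \<in> space M. l' < ennreal \<bar>g x\<bar>} \<subseteq> {x\<in>space M. \<bar>f x\<bar> \<in> ?W}"
    proof safe
      fix x assume x: "x \<in> space M" "l' < ennreal \<bar>g x\<bar>"
      with real l have "l < \<bar>g x\<bar>" by (simp add: ennreal_less_iff)
      with g[OF x(1)] l have gx: "g x = f x" "admissible M f R u \<bar>f x\<bar>" "l < \<bar>f x\<bar>" by auto
      then show "l < \<bar>f x\<bar>" by simp
      show "emeasure M {y\<in>space M. \<bar>f x\<bar> \<le> \<bar>f y\<bar>} \<le> ennreal s"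
      proof (rule ccontr)
        assume "\<not> ?thesis"
        then have "\<bar>f x\<bar> \<le> u s" using gx(2) s unfolding admissible_def by (auto simp: not_le)
        with l gx show False by simp
      qed
    qed
    show ?thesis
    proof (cases "?W = {}")
      case True
      then have "{x \<in> space M. l' < ennreal \<bar>g x\<bar>} = {}" using sub by auto
      then show ?thesis by (simp only:) simp
    next
      case False
      have bdd: "bdd_below ?W" by (rule bdd_belowI[of _ l]) auto
      define v0 where "v0 = Inf ?W"
      have up: "v' \<in> ?W" if "v \<in> ?W" "v \<le> v'" for v v'
      proof -
        have "emeasure M {x\<in>space M. v' \<le> \<bar>f x\<bar>} \<le> emeasure M {x\<in>space M. v \<le> \<bar>f x\<bar>}"
          using that by (intro emeasure_mono) auto
        then show ?thesis using that by auto
      qed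
      have inW: "v \<in> ?W" if "v0 < v" for v
        using that False bdd up unfolding v0_def cInf_less_iff[OF False bdd] by (meson less_imp_le)
      \<comment> \<open>An attained infimum gives a single largest set; otherwise the levels
        \<open>v0 + 1 / (n + 1)\<close> exhaust the union by countably many increasing sets.\<close>
      show ?thesis
      proof (cases "v0 \<in> ?W")
        case True
        have "emeasure M {x \<in> space M. l' < ennreal \<bar>g x\<bar>} \<le> emeasure M {x\<in>space M. v0 \<le> \<bar>f x\<bar>}"
        proof (rule emeasure_mono)
          show "{x \<in> space M. l' < ennreal \<bar>g x\<bar>} \<subseteq> {x\<in>space M. v0 \<le> \<bar>f x\<bar>}"
            using sub cInf_lower[OF _ bdd] unfolding v0_def by blast
        qed auto
        then show ?thesis using True by auto
      next
        case notin: False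
        let ?B = "\<lambda>n. {x\<in>space M. v0 + 1 / real (Suc n) \<le> \<bar>f x\<bar>}"
        have "{x \<in> space M. l' < ennreal \<bar>g x\<bar>} \<subseteq> (\<Union>n. ?B n)"
        proof
          fix x assume "x \<in> {x \<in> space M. l' < ennreal \<bar>g x\<bar>}"
          with sub have x: "x \<in> space M" "\<bar>f x\<bar> \<in> ?W" by auto
          have "v0 \<le> \<bar>f x\<bar>" unfolding v0_def by (rule cInf_lower[OF x(2) bdd])
          moreover have "v0 \<noteq> \<bar>f x\<bar>" using notin x by auto
          ultimately have "0 < \<bar>f x\<bar> - v0" by simp
          then obtain n where "1 / real (Suc n) < \<bar>f x\<bar> - v0" by (rule nat_approx_posE)
          then show "x \<in> (\<Union>n. ?B n)" using x by (auto intro!: exI[of _ n])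
        qed
        then have "emeasure M {x \<in> space M. l' < ennreal \<bar>g x\<bar>} \<le> emeasure M (\<Union>n. ?B n)"
          by (intro emeasure_mono) auto
        also have "\<dots> = (SUP n. emeasure M (?B n))"
        proof (rule SUP_emeasure_incseq[symmetric])
          show "incseq ?B"
          proof (rule incseq_SucI)
            fix n
            have "1 / real (Suc (Suc n)) \<le> 1 / real (Suc n)" by (simp add: frac_le)
            then show "?B n \<subseteq> ?B (Suc n)" by auto
          qed
        qed auto
        also have "\<dots> \<le> ennreal s"
          using inW by (intro SUP_least) (auto simp: mem_Collect_eq)
        finally show ?thesis .
      qed
    qed
  qed simp
qed

text \<open>\<open>g\<close> keeps \<open>f\<close> where the value \<open>|f x|\<close> is
  admissible for \<open>u1\<close>, and \<open>h\<close> keeps the rest, where the value is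
  admissible for \<open>u2\<close> by \<open>admissible_cases\<close>.\<close>

lemma decomposition:
  assumes fm [measurable]: "f \<in> borel_measurable M"
    and anti: "\<And>s t. s \<in> Ioo0 R \<Longrightarrow> t \<in> Ioo0 R \<Longrightarrow> s \<le> t \<Longrightarrow> u1 t \<le> u1 s \<and> u2 t \<le> u2 s"
    and nn: "\<And>s. s \<in> Ioo0 R \<Longrightarrow> 0 \<le> u1 s \<and> 0 \<le> u2 s"
    and bound: "\<And>s. s \<in> Ioo0 R \<Longrightarrow> drearr M f s \<le> ennreal (max (u1 s) (u2 s))"
  obtains g h where "g \<in> borel_measurable M" "h \<in> borel_measurable M" "f = (\<lambda>x. g x + h x)"
    "\<And>s. s \<in> Ioo0 R \<Longrightarrow> drearr M g s \<le> ennreal (u1 s)"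
    "\<And>s. s \<in> Ioo0 R \<Longrightarrow> drearr M h s \<le> ennreal (u2 s)"
proof -
  define g where "g x = f x * indicator {v. admissible M f R u1 v} \<bar>f x\<bar>" for x
  define h where "h x = f x - g x" for x
  have [measurable]: "{v. admissible M f R u1 v} \<in> sets borel" by (rule admissible_set_borel) measurable
  have gm [measurable]: "g \<in> borel_measurable M" unfolding g_def by measurable
  have hm [measurable]: "h \<in> borel_measurable M" unfolding h_def by measurable
  show thesis
  proof
    show "f = (\<lambda>x. g x + h x)" by (simp add: h_def)
    fix s assume s: "s \<in> Ioo0 R"
    show "drearr M g s \<le> ennreal (u1 s)"
      using s nn by (intro drearr_admissible_le[OF fm gm]) (auto simp: g_def indicator_def)
    show "drearr M h s \<le> ennreal (u2 s)"
      using s nn admissible_cases[of f M R u1 u2] anti bound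
      by (intro drearr_admissible_le[OF fm hm]) (auto simp: h_def g_def indicator_def)
  qed (rule gm hm)+
qed

text \<open>The B-condition enters here: it bounds the average of \<open>c / \<phi>\<close> over
  \<open>(0,t)\<close> by a multiple of \<open>c / \<phi> t\<close>. A bound on the rearrangement
  therefore controls a norm that is defined by the maximal function.\<close>

lemma M_norm_le_if_drearr_le:
  assumes B: "0 < B" "\<And>t. t \<in> Ioo0 R \<Longrightarrow>
      (\<integral>\<^sup>+ s\<in>{0<..<t}. ennreal (1 / \<phi> s) \<partial>lborel) / ennreal t \<le> ennreal (B / \<phi> t)"
    and qc: "quasiconcave R \<phi>" and c: "0 \<le> c"
    and g: "\<And>s. s \<in> Ioo0 R \<Longrightarrow> drearr M g s \<le> ennreal (c / \<phi> s)"
  shows "M_norm R \<phi> M g \<le> ennreal (B * c)"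
  unfolding M_norm_def
proof (rule SUP_least)
  fix t assume t: "t \<in> Ioo0 R"
  have pos: "0 < \<phi> s" if "s \<in> Ioo0 R" for s using quasiconcave_pos[OF qc that] .
  have "maxrearr M g t \<le> (\<integral>\<^sup>+ s. ennreal c * (ennreal (1 / \<phi> s) * indicator {0<..<t} s) \<partial>lborel) / ennreal t"
    unfolding maxrearr_def
  proof (intro divide_right_mono_ennreal nn_integral_mono)
    fix s
    have "drearr M g s \<le> ennreal c * ennreal (1 / \<phi> s)" if "0 < s" "s < t"
      using g[of s] Ioo0_downward[OF t, of s] that c pos[of s] by (auto simp flip: ennreal_mult')
    then show "drearr M g s * indicator {0<..<t} s \<le> ennreal c * (ennreal (1 / \<phi> s) * indicator {0<..<t} s)"
      by (auto simp: indicator_def)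
  qed
  also have "(\<integral>\<^sup>+ s. ennreal c * (ennreal (1 / \<phi> s) * indicator {0<..<t} s) \<partial>lborel)
      = ennreal c * (\<integral>\<^sup>+ s\<in>{0<..<t}. ennreal (1 / \<phi> s) \<partial>lborel)"
  proof (rule nn_integral_cmult)
    \<comment> \<open>The behaviour of \<phi> is known only on \<open>[0,R)\<close>, so
      measurability is obtained for its restriction to \<open>(0,t)\<close>.\<close>
    have "mono_on {0<..<t} \<phi>"
      by (intro mono_onI quasiconcave_mono[OF qc]) (auto intro: Ioo0_downward[OF t])
    then have "\<phi> \<in> borel_measurable (restrict_space borel {0<..<t})" by (rule borel_measurable_mono_on_fnc)
    then have "(\<lambda>s. ennreal (1 / \<phi> s)) \<in> borel_measurable (restrict_space borel {0<..<t})" by measurable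
    then show "(\<lambda>s. ennreal (1 / \<phi> s) * indicator {0<..<t} s) \<in> borel_measurable lborel"
      by (subst (asm) borel_measurable_restrict_space_iff_ennreal) auto
  qed
  also have "\<dots> / ennreal t \<le> ennreal c * ennreal (B / \<phi> t)"
    unfolding ennreal_times_divide[symmetric] by (intro mult_left_mono B t) simp
  finally have "ennreal (\<phi> t) * maxrearr M g t \<le> ennreal (\<phi> t) * (ennreal c * ennreal (B / \<phi> t))"
    by (rule mult_left_mono) simp
  also have "\<dots> = ennreal (B * c)"
    using pos[OF t] B c by (simp add: mult_ac flip: ennreal_mult)
  finally show "ennreal (\<phi> t) * maxrearr M g t \<le> ennreal (B * c)" .
qed

lemma maxrearr_le_if_M_norm_le:
  assumes qc: "quasiconcave R \<phi>" and t: "t \<in> Ioo0 R" and "M_norm R \<phi> M g \<le> ennreal c" "0 \<le> c"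
  shows "maxrearr M g t \<le> ennreal (c / \<phi> t)"
proof -
  have pos: "0 < \<phi> t" by (rule quasiconcave_pos[OF qc t])
  have "ennreal (\<phi> t) * maxrearr M g t \<le> ennreal c"
    using assms(3) t unfolding M_norm_def by (auto simp: SUP_le_iff)
  then have "ennreal (1 / \<phi> t) * (ennreal (\<phi> t) * maxrearr M g t) \<le> ennreal (1 / \<phi> t) * ennreal c"
    by (rule mult_left_mono) simp
  then show ?thesis
    using pos assms(4) by (simp add: mult.assoc[symmetric] flip: ennreal_mult)
qed

text \<open>\<open>f\<close> is split with the majorants \<open>N * \<phi> t / \<phi>\<close> and
  \<open>N * \<psi> t / \<psi>\<close>. The pieces have norms of order \<open>N * \<phi> t\<close>
  and \<open>N * \<psi> t\<close>, and evaluating the norms of their images at the same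
  \<open>t\<close> cancels these factors; hence \<open>K\<close> depends on none of
  \<open>f\<close>, \<open>t\<close> and \<open>N\<close>.\<close>

lemma quasilinear_pointwise_bound:
  assumes qc_phi: "quasiconcave R \<phi>" and qc_psi: "quasiconcave R \<psi>"
    and B_phi: "B_condition R \<phi>" and B_psi: "B_condition R \<psi>"
    and ql: "quasilinear M1 M2 (fun_set_plus (M_space R \<phi> M1) (M_space R \<psi> M1)) T"
    and T_phi: "bounded_op (M_space R \<phi> M1) (M_norm R \<phi> M1) (M_space R \<phi> M2) (M_norm R \<phi> M2) T"
    and T_psi: "bounded_op (M_space R \<psi> M1) (M_norm R \<psi> M1) (M_space R \<psi> M2) (M_norm R \<psi> M2) T"
  obtains K where "0 < K"
    "\<And>f t N. f \<in> fun_set_plus (M_space R \<phi> M1) (M_space R \<psi> M1) \<Longrightarrow> t \<in> Ioo0 R \<Longrightarrow> 0 \<le> N \<Longrightarrow>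
       (\<And>s. s \<in> Ioo0 R \<Longrightarrow> maxrearr M1 f s \<le> ennreal (N * max (\<phi> t / \<phi> s) (\<psi> t / \<psi> s))) \<Longrightarrow>
       maxrearr M2 (T f) t \<le> ennreal (K * N)"
proof -
  let ?D = "fun_set_plus (M_space R \<phi> M1) (M_space R \<psi> M1)"
  obtain B1 where B1: "0 < B1" "\<And>t. t \<in> Ioo0 R \<Longrightarrow>
      (\<integral>\<^sup>+ s\<in>{0<..<t}. ennreal (1 / \<phi> s) \<partial>lborel) / ennreal t \<le> ennreal (B1 / \<phi> t)"
    using B_phi unfolding B_condition_def by auto
  obtain B2 where B2: "0 < B2" "\<And>t. t \<in> Ioo0 R \<Longrightarrow>
      (\<integral>\<^sup>+ s\<in>{0<..<t}. ennreal (1 / \<psi> s) \<partial>lborel) / ennreal t \<le> ennreal (B2 / \<psi> t)"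
    using B_psi unfolding B_condition_def by auto
  obtain C1 where C1: "0 \<le> C1" "\<And>f. f \<in> M_space R \<phi> M1 \<Longrightarrow> T f \<in> M_space R \<phi> M2 \<and> M_norm R \<phi> M2 (T f) \<le> ennreal C1 * M_norm R \<phi> M1 f"
    using T_phi unfolding bounded_op_def by auto
  obtain C2 where C2: "0 \<le> C2" "\<And>f. f \<in> M_space R \<psi> M1 \<Longrightarrow> T f \<in> M_space R \<psi> M2 \<and> M_norm R \<psi> M2 (T f) \<le> ennreal C2 * M_norm R \<psi> M1 f"
    using T_psi unfolding bounded_op_def by auto
  obtain C0 where C0: "\<And>f g. f \<in> ?D \<Longrightarrow> g \<in> ?D \<Longrightarrow> AE x in M2. \<bar>T (\<lambda>y. f y + g y) x\<bar> \<le> C0 * (\<bar>T f x\<bar> + \<bar>T g x\<bar>)"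
    using ql unfolding quasilinear_def by meson
  have Tmeas: "T f \<in> borel_measurable M2" if "f \<in> ?D" for f
    using ql that unfolding quasilinear_def by auto
  \<comment> \<open>The quasilinearity constant may have any sign, so a positive majorant is taken.
    In \<open>K\<close> the added 1 secures positivity when both operator bounds are zero.\<close>
  define C where "C = \<bar>C0\<bar> + 1"
  define K where "K = 2 * C * (C1 * B1 + C2 * B2) + 1"
  have C: "0 < C" "C0 \<le> C" by (auto simp: C_def)
  have "0 \<le> 2 * C * (C1 * B1 + C2 * B2)" using C C1(1) C2(1) B1(1) B2(1) by (intro mult_nonneg_nonneg add_nonneg_nonneg) auto
  then have K: "0 < K" "2 * C * (C1 * B1 + C2 * B2) \<le> K" by (auto simp: K_def)
  show thesis
  proof (rule that[OF K(1)])
    fix f t N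
    assume f: "f \<in> ?D" and t: "t \<in> Ioo0 R" and N: "0 \<le> N"
      and bound: "\<And>s. s \<in> Ioo0 R \<Longrightarrow> maxrearr M1 f s \<le> ennreal (N * max (\<phi> t / \<phi> s) (\<psi> t / \<psi> s))"
    note pos1 = quasiconcave_pos[OF qc_phi] and pos2 = quasiconcave_pos[OF qc_psi]
    have t0: "0 < t" using t by (simp add: Ioo0_def)
    have fm: "f \<in> borel_measurable M1" using f unfolding fun_set_plus_def M_space_def by auto
    obtain g h where gh: "g \<in> borel_measurable M1" "h \<in> borel_measurable M1" "f = (\<lambda>x. g x + h x)"
      "\<And>s. s \<in> Ioo0 R \<Longrightarrow> drearr M1 g s \<le> ennreal (N * \<phi> t / \<phi> s)"
      "\<And>s. s \<in> Ioo0 R \<Longrightarrow> drearr M1 h s \<le> ennreal (N * \<psi> t / \<psi> s)"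
    proof (rule decomposition[OF fm, of R "\<lambda>s. N * \<phi> t / \<phi> s" "\<lambda>s. N * \<psi> t / \<psi> s"])
      fix r s assume rs: "r \<in> Ioo0 R" "s \<in> Ioo0 R" "r \<le> s"
      show "N * \<phi> t / \<phi> s \<le> N * \<phi> t / \<phi> r \<and> N * \<psi> t / \<psi> s \<le> N * \<psi> t / \<psi> r"
        using rs N pos1[OF t] pos2[OF t] pos1[OF rs(1)] pos2[OF rs(1)]
          quasiconcave_mono[OF qc_phi rs] quasiconcave_mono[OF qc_psi rs]
        by (intro conjI divide_left_mono mult_nonneg_nonneg mult_pos_pos) auto
    next
      fix s assume s: "s \<in> Ioo0 R"
      show "0 \<le> N * \<phi> t / \<phi> s \<and> 0 \<le> N * \<psi> t / \<psi> s"
        using s t N pos1[of s] pos1[of t] pos2[of s] pos2[of t] by auto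
      have "drearr M1 f s \<le> maxrearr M1 f s" using s by (intro drearr_le_maxrearr) (simp add: Ioo0_def)
      also have "\<dots> \<le> ennreal (N * max (\<phi> t / \<phi> s) (\<psi> t / \<psi> s))" by (rule bound[OF s])
      also have "N * max (\<phi> t / \<phi> s) (\<psi> t / \<psi> s) = max (N * \<phi> t / \<phi> s) (N * \<psi> t / \<psi> s)"
        using N by (simp add: max_mult_distrib_left)
      finally show "drearr M1 f s \<le> ennreal (max (N * \<phi> t / \<phi> s) (N * \<psi> t / \<psi> s))" .
    qed (rule that)
    have a: "0 \<le> N * \<phi> t" "0 \<le> N * \<psi> t" using N pos1[OF t] pos2[OF t] by auto
    have ng: "M_norm R \<phi> M1 g \<le> ennreal (B1 * (N * \<phi> t))"
      by (rule M_norm_le_if_drearr_le[OF B1 qc_phi a(1) gh(4)])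
    have nh: "M_norm R \<psi> M1 h \<le> ennreal (B2 * (N * \<psi> t))"
      by (rule M_norm_le_if_drearr_le[OF B2 qc_psi a(2) gh(5)])
    have gM: "g \<in> M_space R \<phi> M1" using gh(1) ng by (auto simp: M_space_def intro: le_less_trans)
    have hM: "h \<in> M_space R \<psi> M1" using gh(2) nh by (auto simp: M_space_def intro: le_less_trans)
    \<comment> \<open>Since the zero function lies in both spaces, each piece alone belongs to the
      sum space, on which the quasi-additivity of \<open>T\<close> is assumed.\<close>
    have zero: "(\<lambda>_. 0) \<in> M_space R \<phi> M1" "(\<lambda>_. 0) \<in> M_space R \<psi> M1"
    proof -
      have "drearr M1 (\<lambda>_. 0) s \<le> ennreal 0" for s by (rule drearr_leI) auto
      then have "drearr M1 (\<lambda>_. 0) s = 0" for s by simp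
      then have "maxrearr M1 (\<lambda>_. 0) s = 0" for s by (simp add: maxrearr_def)
      then show "(\<lambda>_. 0) \<in> M_space R \<phi> M1" "(\<lambda>_. 0) \<in> M_space R \<psi> M1"
        by (auto simp: M_space_def M_norm_def intro: le_less_trans[OF SUP_least])
    qed
    have gD: "g \<in> ?D" unfolding fun_set_plus_def using gM zero by force
    have hD: "h \<in> ?D" unfolding fun_set_plus_def using hM zero by force
    have "M_norm R \<phi> M2 (T g) \<le> ennreal C1 * ennreal (B1 * (N * \<phi> t))"
      using C1(2)[OF gM] mult_left_mono[OF ng, of "ennreal C1"] by auto
    then have "M_norm R \<phi> M2 (T g) \<le> ennreal (C1 * (B1 * (N * \<phi> t)))"
      using a B1(1) C1(1) by (simp flip: ennreal_mult)
    then have Tg: "maxrearr M2 (T g) t \<le> ennreal (C1 * (B1 * (N * \<phi> t)) / \<phi> t)"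
      using a B1(1) C1(1) by (intro maxrearr_le_if_M_norm_le[OF qc_phi t]) auto
    have "M_norm R \<psi> M2 (T h) \<le> ennreal C2 * ennreal (B2 * (N * \<psi> t))"
      using C2(2)[OF hM] mult_left_mono[OF nh, of "ennreal C2"] by auto
    then have "M_norm R \<psi> M2 (T h) \<le> ennreal (C2 * (B2 * (N * \<psi> t)))"
      using a B2(1) C2(1) by (simp flip: ennreal_mult)
    then have Th: "maxrearr M2 (T h) t \<le> ennreal (C2 * (B2 * (N * \<psi> t)) / \<psi> t)"
      using a B2(1) C2(1) by (intro maxrearr_le_if_M_norm_le[OF qc_psi t]) auto
    have "maxrearr M2 (T f) t \<le> ennreal (2 * C) * (maxrearr M2 (T g) t + maxrearr M2 (T h) t)"
    proof (rule maxrearr_quasi_subadditive[OF Tmeas[OF f] Tmeas[OF gD] Tmeas[OF hD] C(1) _ t0])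
      show "AE x in M2. \<bar>T f x\<bar> \<le> C * (\<bar>T g x\<bar> + \<bar>T h x\<bar>)"
        using C0[OF gD hD] unfolding gh(3)[symmetric]
      proof eventually_elim
        case (elim x)
        also have "C0 * (\<bar>T g x\<bar> + \<bar>T h x\<bar>) \<le> C * (\<bar>T g x\<bar> + \<bar>T h x\<bar>)"
          using C by (intro mult_right_mono) auto
        finally show ?case .
      qed
    qed
    also have "\<dots> \<le> ennreal (2 * C) * (ennreal (C1 * B1 * N) + ennreal (C2 * B2 * N))"
      using Tg Th pos1[OF t] pos2[OF t] by (intro mult_left_mono add_mono) (auto simp: mult.assoc)
    also have "\<dots> = ennreal (2 * C * (C1 * B1 + C2 * B2) * N)"
      using C C1(1) C2(1) B1(1) B2(1) N by (simp add: distrib_right mult.assoc flip: ennreal_plus ennreal_mult)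
    also have "\<dots> \<le> ennreal (K * N)" using K N by (intro ennreal_leI mult_right_mono) auto
    finally show "maxrearr M2 (T f) t \<le> ennreal (K * N)" .
  qed
qed

subsection \<open>Layer-cake representation of the maximal function\<close>

lemma nn_integral_powr_Ioo:
  fixes c q :: real
  assumes "0 \<le> c" "0 \<le> q"
  shows "(\<integral>\<^sup>+ s\<in>{0<..<c}. ennreal (s powr q) \<partial>lborel) = ennreal (c powr (q + 1) / (q + 1))"
proof -
  have "((\<lambda>s. s powr q) has_integral (c powr (q + 1) / (q + 1))) {0..c}"
    using assms by (intro has_integral_powr_from_0) auto
  from nn_integral_has_integral_lebesgue[OF _ this]
  have "(\<integral>\<^sup>+ s. ennreal (s powr q * indicator {0..c} s) \<partial>lborel) = ennreal (c powr (q + 1) / (q + 1))"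
    by (simp add: mult.commute)
  moreover have "(\<integral>\<^sup>+ s\<in>{0<..<c}. ennreal (s powr q) \<partial>lborel)
      = (\<integral>\<^sup>+ s. ennreal (s powr q * indicator {0..c} s) \<partial>lborel)"
  proof (rule nn_integral_cong_AE)
    show "AE s in lborel. ennreal (s powr q) * indicator {0<..<c} s = ennreal (s powr q * indicator {0..c} s)"
      using AE_lborel_singleton[of 0] AE_lborel_singleton[of c]
      by eventually_elim (auto simp: indicator_def)
  qed
  ultimately show ?thesis by simp
qed

text \<open>Distribution function of \<open>k\<close> restricted to \<open>(0,b)\<close>. The cutoff
  keeps the level set of finite measure, so that \<open>measure\<close> is its true length.\<close>

definition level_length :: "(real \<Rightarrow> real) \<Rightarrow> real \<Rightarrow> real \<Rightarrow> real" where
  "level_length k b l = measure lborel {s. 0 < s \<and> s < b \<and> l < k s}"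

context
  fixes k :: "real \<Rightarrow> real"
  assumes k: "antimono_on {0<..} k" "k \<in> borel_measurable borel"
begin

lemma level_set_sets [measurable]: "{s. 0 < s \<and> s < b \<and> l < k s} \<in> sets borel"
proof -
  have [measurable]: "k \<in> borel_measurable borel" by (rule k)
  have "{s \<in> space borel. 0 < s \<and> s < b \<and> l < k s} \<in> sets borel" by measurable
  then show ?thesis by simp
qed

lemma level_set_fmeasurable: "{s. 0 < s \<and> s < b \<and> l < k s} \<in> fmeasurable lborel"
proof (rule fmeasurableI2)
  show "{0..b} \<in> fmeasurable lborel" by (rule fmeasurableI) (auto simp: emeasure_lborel_Icc_eq)
qed auto

lemma level_length_mono:
  assumes "b \<le> b'" "l' \<le> l"
  shows "level_length k b l \<le> level_length k b' l'"
  unfolding level_length_def using assms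
  by (intro measure_mono_fmeasurable level_set_fmeasurable) auto

lemma borel_measurable_level_length [measurable]: "level_length k b \<in> borel_measurable borel"
proof -
  have "mono (\<lambda>l. - level_length k b l)" by (intro monoI) (simp add: level_length_mono)
  then have "(\<lambda>l. - (- level_length k b l)) \<in> borel_measurable borel"
    by (intro borel_measurable_uminus borel_measurable_mono)
  then show ?thesis by simp
qed

lemma level_length_nonneg: "0 \<le> level_length k b l"
  by (simp add: level_length_def)

lemma level_length_le: "0 \<le> b \<Longrightarrow> level_length k b l \<le> b"
proof -
  assume "0 \<le> b"
  have "level_length k b l \<le> measure lborel {0..b}"
    unfolding level_length_def
    by (intro measure_mono_fmeasurable fmeasurableI) (auto simp: emeasure_lborel_Icc_eq)
  then show ?thesis using \<open>0 \<le> b\<close> by simp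
qed

text \<open>The level set of a non-increasing function is an initial segment of
  \<open>(0,b)\<close>. Its right end may or may not belong to it, so this single point is excluded;
  it is negligible under the integral.\<close>

lemma level_set_iff:
  assumes s: "0 < s" "s < b" "s \<noteq> level_length k b l"
  shows "l < k s \<longleftrightarrow> s < level_length k b l"
proof
  assume "l < k s"
  then have "{0<..s} \<subseteq> {s. 0 < s \<and> s < b \<and> l < k s}"
    using s monotone_onD[OF k(1)] by (fastforce intro: less_le_trans)
  then have "measure lborel {0<..s} \<le> level_length k b l"
    unfolding level_length_def by (intro measure_mono_fmeasurable level_set_fmeasurable) auto
  then show "s < level_length k b l" using s by simp
next
  assume less: "s < level_length k b l"
  show "l < k s"
  proof (rule ccontr)
    assume "\<not> l < k s"
    have "x < s" if "0 < x" "l < k x" for x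
    proof (rule ccontr)
      assume "\<not> x < s"
      then have "k x \<le> k s" using s that by (intro monotone_onD[OF k(1)]) auto
      with \<open>\<not> l < k s\<close> that show False by simp
    qed
    then have "{s. 0 < s \<and> s < b \<and> l < k s} \<subseteq> {0..s}" by fastforce
    then have "level_length k b l \<le> measure lborel {0..s}"
      unfolding level_length_def
      by (intro measure_mono_fmeasurable fmeasurableI) (auto simp: emeasure_lborel_Icc_eq)
    with s less show False by simp
  qed
qed

text \<open>Write \<open>k s\<close> as the length of the set of levels between 0 and
  \<open>k s\<close> and exchange the integrals. By \<open>level_set_iff\<close> the inner integral
  is that of \<open>s powr (p - 1)\<close> up to \<open>min (level_length k b l) t\<close>, which is
  the \<open>p\<close>-th power of this endpoint divided by \<open>p\<close>.\<close>

lemma layer_cake: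
  assumes nn: "\<And>s. 0 \<le> k s" and p: "1 \<le> p" and bt: "0 \<le> b" "0 \<le> t"
  shows "(\<integral>\<^sup>+ l\<in>{0<..}. ennreal (min (level_length k b l) t powr p) \<partial>lborel)
    = ennreal p * (\<integral>\<^sup>+ s\<in>{0<..<min b t}. ennreal (k s * s powr (p - 1)) \<partial>lborel)"
proof -
  have [measurable]: "k \<in> borel_measurable borel" by (rule k)
  let ?g = "\<lambda>l s :: real. ennreal (s powr (p - 1)) * indicator {0<..<min b t} s * indicator {0<..} l * indicator {l. 0 < k s - l} l"
  have meas: "case_prod ?g \<in> borel_measurable (lborel \<Otimes>\<^sub>M lborel)"
    unfolding indicator_def mem_Collect_eq by measurable
  have "(\<integral>\<^sup>+ s\<in>{0<..<min b t}. ennreal (k s * s powr (p - 1)) \<partial>lborel) = (\<integral>\<^sup>+ s. (\<integral>\<^sup>+ l. ?g l s \<partial>lborel) \<partial>lborel)"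
  proof (rule nn_integral_cong)
    fix s
    have "(\<integral>\<^sup>+ l. ?g l s \<partial>lborel)
        = (\<integral>\<^sup>+ l. (ennreal (s powr (p - 1)) * indicator {0<..<min b t} s) * indicator {0<..<k s} l \<partial>lborel)"
      by (intro nn_integral_cong) (auto simp: indicator_def)
    also have "\<dots> = ennreal (k s * s powr (p - 1)) * indicator {0<..<min b t} s"
      using nn[of s] by (subst nn_integral_cmult_indicator) (auto simp: ennreal_mult mult_ac)
    finally show "ennreal (k s * s powr (p - 1)) * indicator {0<..<min b t} s = (\<integral>\<^sup>+ l. ?g l s \<partial>lborel)" ..
  qed
  also have "\<dots> = (\<integral>\<^sup>+ l. (\<integral>\<^sup>+ s. ?g l s \<partial>lborel) \<partial>lborel)"
    by (rule lborel_pair.Fubini'[OF meas])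
  also have "\<dots> = (\<integral>\<^sup>+ l. ennreal (1 / p) * (ennreal (min (level_length k b l) t powr p) * indicator {0<..} l) \<partial>lborel)"
  proof (rule nn_integral_cong)
    fix l
    have le: "level_length k b l \<le> b" by (rule level_length_le) (rule bt)
    have "(\<integral>\<^sup>+ s. ?g l s \<partial>lborel)
        = (\<integral>\<^sup>+ s. indicator {0<..} l * (ennreal (s powr (p - 1)) * indicator {0<..<min (level_length k b l) t} s) \<partial>lborel)"
    proof (rule nn_integral_cong_AE)
      show "AE s in lborel. ?g l s = indicator {0<..} l * (ennreal (s powr (p - 1)) * indicator {0<..<min (level_length k b l) t} s)"
        using AE_lborel_singleton[of "level_length k b l"]
      proof eventually_elim
        case (elim s)
        then show ?case using level_set_iff[of s b l] le by (auto simp: indicator_def)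
      qed
    qed
    also have "\<dots> = indicator {0<..} l * ennreal (min (level_length k b l) t powr p / p)"
      using p bt level_length_nonneg[of b l]
      by (subst nn_integral_cmult) (auto simp: nn_integral_powr_Ioo)
    also have "\<dots> = ennreal (1 / p) * (ennreal (min (level_length k b l) t powr p) * indicator {0<..} l)"
    proof -
      have "ennreal (m / p) = ennreal (1 / p) * ennreal m" if "0 \<le> m" for m
        using p that by (simp flip: ennreal_mult)
      from this[of "min (level_length k b l) t powr p"] show ?thesis by (simp only: powr_ge_zero mult_ac)
    qed
    finally show "(\<integral>\<^sup>+ s. ?g l s \<partial>lborel) = \<dots>" .
  qed
  also have "\<dots> = ennreal (1 / p) * (\<integral>\<^sup>+ l\<in>{0<..}. ennreal (min (level_length k b l) t powr p) \<partial>lborel)"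
    by (rule nn_integral_cmult) measurable
  finally have "ennreal p * (\<integral>\<^sup>+ s\<in>{0<..<min b t}. ennreal (k s * s powr (p - 1)) \<partial>lborel)
      = (ennreal p * ennreal (1 / p)) * (\<integral>\<^sup>+ l\<in>{0<..}. ennreal (min (level_length k b l) t powr p) \<partial>lborel)"
    by (simp only: mult.assoc)
  moreover have "ennreal p * ennreal (1 / p) = 1" using p by (simp flip: ennreal_mult)
  ultimately show ?thesis by simp
qed

end

section \<open>Primitives of non-increasing densities, modelled on the rearrangement\<close>

locale decreasing_density =
  fixes w :: "real \<Rightarrow> real"
  assumes w_meas [measurable]: "w \<in> borel_measurable borel"
    and w_nonneg: "0 \<le> w s"
    and w_antimono: "antimono_on {0<..} w"
    and w_finite: "0 < t \<Longrightarrow> (\<integral>\<^sup>+ s\<in>{0<..<t}. ennreal (w s) \<partial>lborel) < \<infinity>"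
begin

definition F :: "real \<Rightarrow> real" where
  "F t = enn2real (\<integral>\<^sup>+ s\<in>{0<..<t}. ennreal (w s) \<partial>lborel)"

text \<open>\<open>w s * F s powr (p - 1)\<close> is formally the derivative of
  \<open>F s powr p / p\<close>. Dividing it by \<open>s powr (p - 1)\<close> leaves a product of
  non-increasing factors, to which \<open>layer_cake\<close> applies.\<close>

definition k :: "real \<Rightarrow> real \<Rightarrow> real" where
  "k p s = w s * (F s / s) powr (p - 1)"

lemma F_nonneg: "0 \<le> F t"
  by (simp add: F_def)

lemma ennreal_F: "ennreal (F t) = (\<integral>\<^sup>+ s\<in>{0<..<t}. ennreal (w s) \<partial>lborel)"
proof (cases "0 < t")
  case True
  then show ?thesis using w_finite[of t] by (simp add: F_def ennreal_enn2real_if)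
qed (simp add: F_def)

lemma F_mono: "s \<le> t \<Longrightarrow> F s \<le> F t"
proof -
  assume "s \<le> t"
  then have "ennreal (F s) \<le> ennreal (F t)"
    unfolding ennreal_F by (intro nn_integral_mono) (auto simp: indicator_def)
  then show ?thesis by (simp add: F_nonneg)
qed

lemma F_scale: "0 < s \<Longrightarrow> s \<le> t \<Longrightarrow> F t \<le> t / s * F s"
proof -
  assume "0 < s" "s \<le> t"
  then have "ennreal (F t) \<le> ennreal (t / s) * ennreal (F s)"
    unfolding ennreal_F
    by (intro nn_integral_antimono_scale monotone_onI ennreal_leI monotone_onD[OF w_antimono]) auto
  then show ?thesis using \<open>0 < s\<close> \<open>s \<le> t\<close> by (simp add: F_nonneg flip: ennreal_mult)
qed

lemma F_measurable [measurable]: "F \<in> borel_measurable borel"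
  by (intro borel_measurable_mono monoI F_mono)

lemma k_measurable [measurable]: "k p \<in> borel_measurable borel"
  unfolding k_def[abs_def] by measurable

lemma k_nonneg: "0 \<le> k p s"
  by (simp add: k_def w_nonneg)

lemma k_antimono: "1 \<le> p \<Longrightarrow> antimono_on {0<..} (k p)"
proof (rule monotone_onI)
  fix s t :: real assume p: "1 \<le> p" and st: "s \<in> {0<..}" "t \<in> {0<..}" "s \<le> t"
  have "F t / t \<le> F s / s" using F_scale[of s t] st by (simp add: field_simps)
  then show "k p t \<le> k p s"
    unfolding k_def using st p
    by (intro mult_mono powr_mono2 monotone_onD[OF w_antimono] w_nonneg) (auto simp: F_nonneg)
qed

lemma k_times_powr: "0 < s \<Longrightarrow> k p s * s powr (p - 1) = w s * F s powr (p - 1)"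
  by (simp add: k_def powr_divide F_nonneg)

text \<open>\<open>u\<close> is the first of the points \<open>t/2\<^sup>m\<close> beyond which half of the mass lies; since \<open>F\<close> at most
  doubles when its argument does, \<open>F u\<close> is still a fixed fraction of \<open>F t\<close>.\<close>

lemma F_halving:
  assumes t: "0 < t" "0 < F t"
  obtains u where "0 < u" "u < t" "F t / 4 \<le> F u"
    "ennreal (F t / 2) \<le> (\<integral>\<^sup>+ s\<in>{u..<t}. ennreal (w s) \<partial>lborel)"
proof -
  let ?u = "\<lambda>j. t / 2 ^ j"
  let ?G = "\<lambda>u. \<integral>\<^sup>+ s\<in>{u..<t}. ennreal (w s) \<partial>lborel"
  have split: "ennreal (F t) = ennreal (F u) + ?G u" if "0 < u" "u \<le> t" for u
    unfolding ennreal_F using that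
    by (subst nn_integral_add[symmetric]) (auto intro!: nn_integral_cong simp: indicator_def)
  \<comment> \<open>As \<open>t / 2 ^ j\<close> tends to 0, monotone convergence makes the supremum
    of the masses on \<open>[t / 2 ^ j, t)\<close> at least \<open>F t\<close>, so one of them
    exceeds half of it.\<close>
  have "(SUP j. ?G (?u j)) = (\<integral>\<^sup>+ s. (SUP j. ennreal (w s) * indicator {?u j..<t} s) \<partial>lborel)"
  proof (rule nn_integral_monotone_convergence_SUP[symmetric])
    show "incseq (\<lambda>j s. ennreal (w s) * indicator {?u j..<t} s)"
    proof (rule incseq_SucI, rule le_funI)
      fix j s
      have "?u (Suc j) \<le> ?u j" using t by (simp add: field_simps)
      then show "ennreal (w s) * indicator {?u j..<t} s \<le> ennreal (w s) * indicator {?u (Suc j)..<t} s"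
        by (auto simp: indicator_def)
    qed
  qed simp
  also have "\<dots> \<ge> ennreal (F t)"
    unfolding ennreal_F
  proof (rule nn_integral_mono)
    fix s
    show "ennreal (w s) * indicator {0<..<t} s \<le> (SUP j. ennreal (w s) * indicator {?u j..<t} s)"
    proof (cases "0 < s \<and> s < t")
      case True
      obtain j where "t / s < 2 ^ j" using real_arch_pow[of 2 "t / s"] by auto
      then have "?u j \<le> s" using True by (simp add: field_simps)
      then show ?thesis using True by (intro SUP_upper2[of j]) auto
    qed auto
  qed
  finally have ge: "ennreal (F t) \<le> (SUP j. ?G (?u j))" .
  have "ennreal (F t / 2) < ennreal (F t)" using t by (simp add: ennreal_less_iff)
  then have "ennreal (F t / 2) < (SUP j. ?G (?u j))" using ge by (rule less_le_trans)
  then obtain j where j: "ennreal (F t / 2) < ?G (?u j)" unfolding less_SUP_iff by blast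
  define m where "m = (LEAST j. ennreal (F t / 2) < ?G (?u j))"
  have m: "ennreal (F t / 2) < ?G (?u m)" unfolding m_def by (rule LeastI) (rule j)
  \<comment> \<open>For \<open>m = 0\<close> the interval is empty and carries no mass; hence there
    is a preceding index \<open>i\<close>.\<close>
  have "m \<noteq> 0"
  proof
    assume "m = 0"
    with m show False by simp
  qed
  then obtain i where i: "m = Suc i" by (cases m) auto
  \<comment> \<open>Minimality of \<open>m\<close> leaves at most half of the mass beyond
    \<open>t / 2 ^ i\<close>, so \<open>F\<close> is at least \<open>F t / 2\<close> there; one more
    halving of the argument loses at most a factor 2.\<close>
  have "\<not> ennreal (F t / 2) < ?G (?u i)"
    using i not_less_Least[of i "\<lambda>j. ennreal (F t / 2) < ?G (?u j)"] by (simp add: m_def)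
  then have "ennreal (F t) \<le> ennreal (F (?u i)) + ennreal (F t / 2)"
    using t split[of "?u i"] by (auto simp: not_less divide_le_eq intro: add_left_mono)
  then have "F t / 2 \<le> F (?u i)" using t by (simp add: F_nonneg flip: ennreal_plus)
  moreover have "F (?u i) \<le> 2 * F (?u m)"
    using F_scale[of "?u m" "?u i"] t by (simp add: i field_simps)
  ultimately have "F t / 4 \<le> F (?u m)" by simp
  moreover have "(1::real) < 2 ^ m" using i by (intro one_less_power) auto
  then have "?u m < t" using t by (simp add: divide_less_eq)
  ultimately show thesis using m t by (intro that[of "?u m"]) auto
qed

text \<open>Inside the integral \<open>F s\<close> is replaced by the larger \<open>F t\<close>; the
  remaining integral of \<open>w\<close> is again \<open>F t\<close>.\<close>

lemma nn_integral_k_le: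
  assumes p: "1 \<le> p" and t: "0 < t"
  shows "(\<integral>\<^sup>+ s\<in>{0<..<t}. ennreal (k p s * s powr (p - 1)) \<partial>lborel) \<le> ennreal (F t powr p)"
proof -
  have "(\<integral>\<^sup>+ s\<in>{0<..<t}. ennreal (k p s * s powr (p - 1)) \<partial>lborel)
      \<le> (\<integral>\<^sup>+ s. ennreal (F t powr (p - 1)) * (ennreal (w s) * indicator {0<..<t} s) \<partial>lborel)"
  proof (rule nn_integral_mono)
    fix s
    have "w s * F s powr (p - 1) \<le> w s * F t powr (p - 1)" if "0 < s" "s < t"
      using that p by (intro mult_left_mono powr_mono2) (auto simp: F_nonneg F_mono w_nonneg)
    then show "ennreal (k p s * s powr (p - 1)) * indicator {0<..<t} s
        \<le> ennreal (F t powr (p - 1)) * (ennreal (w s) * indicator {0<..<t} s)"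
      by (auto simp: indicator_def k_times_powr w_nonneg mult.commute simp flip: ennreal_mult intro!: ennreal_leI)
  qed
  also have "\<dots> = ennreal (F t powr (p - 1)) * ennreal (F t)"
    unfolding ennreal_F by (rule nn_integral_cmult) measurable
  also have "\<dots> = ennreal (F t powr p)"
    using powr_mult_base[OF F_nonneg, of t "p - 1"] by (simp add: F_nonneg mult.commute flip: ennreal_mult)
  finally show ?thesis .
qed

text \<open>On the interval \<open>[u,t)\<close> from \<open>F_halving\<close>, \<open>F\<close> is
  at least \<open>F t / 4\<close> and \<open>w\<close> has mass at least \<open>F t / 2\<close>.
  This explains the constant and avoids differentiating \<open>F s powr p\<close>.\<close>

lemma nn_integral_k_ge:
  assumes p: "1 \<le> p" and t: "0 < t"
  shows "ennreal (F t powr p / (2 * 4 powr (p - 1))) \<le> (\<integral>\<^sup>+ s\<in>{0<..<t}. ennreal (k p s * s powr (p - 1)) \<partial>lborel)"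
proof (cases "F t = 0")
  case True
  then show ?thesis by simp
next
  case False
  then have Ft: "0 < F t" using F_nonneg[of t] by simp
  obtain u where u: "0 < u" "u < t" "F t / 4 \<le> F u"
    "ennreal (F t / 2) \<le> (\<integral>\<^sup>+ s\<in>{u..<t}. ennreal (w s) \<partial>lborel)"
    using F_halving[OF t Ft] .
  have eq: "F t powr p / (2 * 4 powr (p - 1)) = (F t / 4) powr (p - 1) * (F t / 2)"
    using powr_mult_base[of "F t" "p - 1"] Ft by (simp add: powr_divide mult.commute)
  have "ennreal (F t powr p / (2 * 4 powr (p - 1))) = ennreal ((F t / 4) powr (p - 1)) * ennreal (F t / 2)"
    unfolding eq using Ft by (intro ennreal_mult) auto
  also have "\<dots> \<le> ennreal ((F t / 4) powr (p - 1)) * (\<integral>\<^sup>+ s\<in>{u..<t}. ennreal (w s) \<partial>lborel)"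
    by (intro mult_left_mono u) simp
  also have "\<dots> = (\<integral>\<^sup>+ s. ennreal ((F t / 4) powr (p - 1)) * (ennreal (w s) * indicator {u..<t} s) \<partial>lborel)"
    by (rule nn_integral_cmult[symmetric]) measurable
  also have "\<dots> \<le> (\<integral>\<^sup>+ s\<in>{0<..<t}. ennreal (k p s * s powr (p - 1)) \<partial>lborel)"
  proof (rule nn_integral_mono)
    fix s
    have "(F t / 4) powr (p - 1) * w s \<le> k p s * s powr (p - 1)" if "u \<le> s" "s < t"
    proof -
      have "(F t / 4) powr (p - 1) \<le> F s powr (p - 1)"
        using that p Ft u F_mono[of u s] by (intro powr_mono2) auto
      then show ?thesis
        using that u w_nonneg[of s] by (simp add: k_times_powr mult.commute mult_left_mono)
    qed
    then show "ennreal ((F t / 4) powr (p - 1)) * (ennreal (w s) * indicator {u..<t} s)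
        \<le> ennreal (k p s * s powr (p - 1)) * indicator {0<..<t} s"
      using u by (auto simp: indicator_def w_nonneg simp flip: ennreal_mult intro!: ennreal_leI)
  qed
  finally show ?thesis .
qed

end

subsection \<open>The weighted inequality\<close>

text \<open>The power spelled out in \<open>Gamma_norm\<close>, used both for the integrand and for
  the root outside the integral.\<close>

definition ennpow :: "ennreal \<Rightarrow> real \<Rightarrow> ennreal" where
  "ennpow x q = (if x = \<infinity> then \<infinity> else ennreal (enn2real x powr q))"

lemma ennpow_ennreal: "0 \<le> x \<Longrightarrow> ennpow (ennreal x) q = ennreal (x powr q)"
  by (simp add: ennpow_def)

lemma ennpow_mono: "0 \<le> q \<Longrightarrow> x \<le> y \<Longrightarrow> ennpow x q \<le> ennpow y q"
  by (cases x; cases y) (auto simp: ennpow_def top_unique intro!: powr_mono2)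

lemma ennpow_cmult: "0 < c \<Longrightarrow> ennpow (ennreal c * x) q = ennreal (c powr q) * ennpow x q"
  by (cases x) (auto simp: ennpow_def ennreal_mult_top powr_mult ennreal_mult simp flip: ennreal_mult)

lemma Gamma_norm_eq:
  "Gamma_norm R p w M f = ennpow (\<integral>\<^sup>+ t\<in>Ioo0 R. ennpow (maxrearr M f t) p * ennreal (w t) \<partial>lborel) (1 / p)"
  by (simp add: Gamma_norm_def ennpow_def Let_def)

text \<open>Supplies cutoffs for \<open>level_length\<close>: a cutoff inside \<open>(0,R)\<close>
  keeps the level lengths below \<open>R\<close>, whether \<open>R\<close> is finite or not.\<close>

lemma Ioo0_exhaustion:
  assumes "0 < R"
  obtains b :: "nat \<Rightarrow> real" where "incseq b" "\<And>n. b n \<in> Ioo0 R" "\<And>t. t \<in> Ioo0 R \<Longrightarrow> \<exists>n. t \<le> b n"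
proof (cases R)
  case top
  show thesis
  proof
    show "incseq (\<lambda>n. real (Suc n))" by (auto simp: incseq_def)
    show "real (Suc n) \<in> Ioo0 R" for n using top by (simp add: Ioo0_def)
    show "\<exists>n. t \<le> real (Suc n)" for t
      using real_arch_simple[of "t - 1"] by (auto simp: algebra_simps)
  qed
next
  case (real r)
  with assms have r: "0 < r" by auto
  \<comment> \<open>Starting the denominators at 2 makes the first point \<open>r / 2\<close>, which
    is positive.\<close>
  let ?b = "\<lambda>n. r * (1 - 1 / real (Suc (Suc n)))"
  show thesis
  proof
    show "incseq ?b" using r by (intro incseq_SucI mult_left_mono diff_left_mono) (auto simp: frac_le)
    show "?b n \<in> Ioo0 R" for n
    proof -
      have "0 < 1 - 1 / real (Suc (Suc n))" by simp
      moreover have "?b n < r * 1" using r by (intro mult_strict_left_mono) auto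
      ultimately show ?thesis using r real by (simp add: Ioo0_def ennreal_less_iff)
    qed
    fix t assume "t \<in> Ioo0 R"
    then have t: "0 < t" "t < r" using real by (auto simp: Ioo0_def ennreal_less_iff)
    then have "0 < 1 - t / r" by simp
    then obtain n where "1 / real (Suc n) < 1 - t / r" by (rule nat_approx_posE)
    moreover have "1 / real (Suc (Suc n)) \<le> 1 / real (Suc n)" by (simp add: frac_le)
    ultimately have "t / r \<le> 1 - 1 / real (Suc (Suc n))" by simp
    then show "\<exists>n. t \<le> ?b n" using r by (intro exI[of _ n]) (simp add: pos_divide_le_eq mult.commute)
  qed
qed

lemma Ioo0_borel [measurable]: "Ioo0 R \<in> sets borel"
proof -
  have "{t \<in> space borel. 0 < t \<and> ennreal t < R} \<in> sets borel" by measurable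
  then show ?thesis by (simp add: Ioo0_def)
qed

lemma IooR_borel [measurable]: "IooR t R \<in> sets borel"
proof -
  have "{s \<in> space borel. t < s \<and> ennreal s < R} \<in> sets borel" by measurable
  then show ?thesis by (simp add: IooR_def)
qed

lemma quasiconcave_zero: "0 < R \<Longrightarrow> quasiconcave R \<phi> \<Longrightarrow> \<phi> 0 = 0"
  by (simp add: quasiconcave_def Ico0_def)

text \<open>For \<open>a \<le> s\<close> this is the monotonicity of \<open>\<phi> t / t\<close>,
  for \<open>s \<le> a\<close> that of \<phi>. The value \<open>a = 0\<close> is included because
  level lengths may vanish.\<close>

lemma quasiconcave_min_scale:
  assumes qc: "quasiconcave R \<phi>" and R: "0 < R" and s: "s \<in> Ioo0 R" and a: "a = 0 \<or> a \<in> Ioo0 R"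
  shows "min a s / s \<le> \<phi> a / \<phi> s"
proof -
  have s0: "0 < s" using s by (simp add: Ioo0_def)
  have pos: "0 < \<phi> s" by (rule quasiconcave_pos[OF qc s])
  consider "a = 0" | "a \<in> Ioo0 R" "s \<le> a" | "a \<in> Ioo0 R" "a \<le> s" using a by linarith
  then show ?thesis
  proof cases
    case 1
    then show ?thesis using s0 quasiconcave_zero[OF R qc] by simp
  next
    case 2
    then show ?thesis using s0 pos quasiconcave_mono[OF qc s 2(1) 2(2)] by simp
  next
    case 3
    then have "0 < a" by (simp add: Ioo0_def)
    moreover have "\<phi> s / s \<le> \<phi> a / a" using qc s 3 by (auto simp: quasiconcave_def)
    ultimately show ?thesis using s0 pos 3 by (simp add: field_simps)
  qed
qed

text \<open>Both \<open>\<phi> a / \<phi> s\<close> and \<open>\<psi> a / \<psi> s\<close> dominate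
  \<open>min a s / s\<close>. Inserting \<open>t\<close> factors each of them; whichever factor in
  \<open>a\<close> attains the minimum, its companion in \<open>s\<close> is at most the
  maximum.\<close>

lemma min_scale_le_min_max:
  assumes phi: "quasiconcave R \<phi>" and psi: "quasiconcave R \<psi>" and R: "0 < R"
    and s: "s \<in> Ioo0 R" and t: "t \<in> Ioo0 R" and a: "a = 0 \<or> a \<in> Ioo0 R"
  shows "min a s / s \<le> max (\<phi> t / \<phi> s) (\<psi> t / \<psi> s) * min (\<phi> a / \<phi> t) (\<psi> a / \<psi> t)"
proof -
  have pos: "0 < \<phi> s" "0 < \<phi> t" "0 < \<psi> s" "0 < \<psi> t"
    using quasiconcave_pos[OF phi s] quasiconcave_pos[OF phi t] quasiconcave_pos[OF psi s] quasiconcave_pos[OF psi t] by auto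
  have nn: "0 \<le> \<phi> a" "0 \<le> \<psi> a"
    using a quasiconcave_zero[OF R phi] quasiconcave_zero[OF R psi]
      quasiconcave_pos[OF phi, of a] quasiconcave_pos[OF psi, of a] by (auto intro: less_imp_le)
  have "\<phi> a / \<phi> s \<le> max (\<phi> t / \<phi> s) (\<psi> t / \<psi> s) * (\<phi> a / \<phi> t)"
  proof -
    have "\<phi> a / \<phi> s = \<phi> t / \<phi> s * (\<phi> a / \<phi> t)" using pos by simp
    also have "\<dots> \<le> max (\<phi> t / \<phi> s) (\<psi> t / \<psi> s) * (\<phi> a / \<phi> t)"
      using pos nn by (intro mult_right_mono) auto
    finally show ?thesis .
  qed
  moreover have "\<psi> a / \<psi> s \<le> max (\<phi> t / \<phi> s) (\<psi> t / \<psi> s) * (\<psi> a / \<psi> t)"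
  proof -
    have "\<psi> a / \<psi> s = \<psi> t / \<psi> s * (\<psi> a / \<psi> t)" using pos by simp
    also have "\<dots> \<le> max (\<phi> t / \<phi> s) (\<psi> t / \<psi> s) * (\<psi> a / \<psi> t)"
      using pos nn by (intro mult_right_mono) auto
    finally show ?thesis .
  qed
  ultimately show ?thesis
    using quasiconcave_min_scale[OF phi R s a] quasiconcave_min_scale[OF psi R s a]
    by (auto simp: min_def)
qed

text \<open>Bounding the minimum by the \<psi>-quotient on \<open>(0,a)\<close> and by the
  \<phi>-quotient on \<open>(a,R)\<close> produces the left side of \<open>cond\<close>. On the
  other side \<open>min a t / t\<close> is 1 below \<open>a\<close> and \<open>a / t\<close> above,
  which matches the two terms on the right of \<open>cond\<close>.\<close>

lemma test_function_inequality:
  assumes [measurable]: "\<phi> \<in> borel_measurable borel" "\<psi> \<in> borel_measurable borel"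
      "w1 \<in> borel_measurable borel" "w2 \<in> borel_measurable borel"
    and phi: "quasiconcave R \<phi>" and psi: "quasiconcave R \<psi>"
    and p: "0 \<le> p" and a: "a \<in> Ioo0 R"
    and cond: "ennreal (\<psi> a powr p) * (\<integral>\<^sup>+ s\<in>{0<..<a}. ennreal (\<psi> s powr (-p) * w2 s) \<partial>lborel)
         + ennreal (\<phi> a powr p) * (\<integral>\<^sup>+ s\<in>IooR a R. ennreal (\<phi> s powr (-p) * w2 s) \<partial>lborel)
       \<le> ennreal K * ((\<integral>\<^sup>+ s\<in>{0<..<a}. ennreal (w1 s) \<partial>lborel)
         + ennreal (a powr p) * (\<integral>\<^sup>+ s\<in>IooR a R. ennreal (s powr (-p) * w1 s) \<partial>lborel))"
  shows "(\<integral>\<^sup>+ t\<in>Ioo0 R. ennreal (min (\<phi> a / \<phi> t) (\<psi> a / \<psi> t) powr p) * ennreal (w2 t) \<partial>lborel)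
    \<le> ennreal K * (\<integral>\<^sup>+ t\<in>Ioo0 R. ennreal ((min a t / t) powr p) * ennreal (w1 t) \<partial>lborel)"
proof -
  have a0: "0 < a" using a by (simp add: Ioo0_def)
  have pos: "0 < \<phi> t" "0 < \<psi> t" if "t \<in> Ioo0 R" for t
    using quasiconcave_pos[OF phi that] quasiconcave_pos[OF psi that] by auto
  have sub: "t \<in> Ioo0 R" if "0 < t" "t < a" for t using Ioo0_downward[OF a, of t] that by simp
  have sub': "t \<in> Ioo0 R" if "t \<in> IooR a R" for t using that a0 by (simp add: Ioo0_def IooR_def)
  have pw: "min (\<phi> a / \<phi> t) (\<psi> a / \<psi> t) powr p \<le> \<phi> a powr p * \<phi> t powr (-p)"
      "min (\<phi> a / \<phi> t) (\<psi> a / \<psi> t) powr p \<le> \<psi> a powr p * \<psi> t powr (-p)" if "t \<in> Ioo0 R" for t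
  proof -
    have "min (\<phi> a / \<phi> t) (\<psi> a / \<psi> t) powr p \<le> (\<phi> a / \<phi> t) powr p"
      "min (\<phi> a / \<phi> t) (\<psi> a / \<psi> t) powr p \<le> (\<psi> a / \<psi> t) powr p"
      using pos[OF a] pos[OF that] p by (auto intro!: powr_mono2)
    moreover have "(\<phi> a / \<phi> t) powr p = \<phi> a powr p * \<phi> t powr (-p)"
      "(\<psi> a / \<psi> t) powr p = \<psi> a powr p * \<psi> t powr (-p)"
      using pos[OF a] pos[OF that] by (auto simp: powr_divide powr_minus_divide)
    ultimately show "min (\<phi> a / \<phi> t) (\<psi> a / \<psi> t) powr p \<le> \<phi> a powr p * \<phi> t powr (-p)"
      "min (\<phi> a / \<phi> t) (\<psi> a / \<psi> t) powr p \<le> \<psi> a powr p * \<psi> t powr (-p)"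
      by simp_all
  qed
  have "(\<integral>\<^sup>+ t\<in>Ioo0 R. ennreal (min (\<phi> a / \<phi> t) (\<psi> a / \<psi> t) powr p) * ennreal (w2 t) \<partial>lborel)
     \<le> (\<integral>\<^sup>+ t. ennreal (\<psi> a powr p) * (ennreal (\<psi> t powr (-p) * w2 t) * indicator {0<..<a} t)
         + ennreal (\<phi> a powr p) * (ennreal (\<phi> t powr (-p) * w2 t) * indicator (IooR a R) t) \<partial>lborel)"
  proof (rule nn_integral_mono_AE)
    show "AE t in lborel. ennreal (min (\<phi> a / \<phi> t) (\<psi> a / \<psi> t) powr p) * ennreal (w2 t) * indicator (Ioo0 R) t
      \<le> ennreal (\<psi> a powr p) * (ennreal (\<psi> t powr (-p) * w2 t) * indicator {0<..<a} t)
         + ennreal (\<phi> a powr p) * (ennreal (\<phi> t powr (-p) * w2 t) * indicator (IooR a R) t)"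
      \<comment> \<open>The point \<open>a\<close> lies in neither of the two intervals.\<close>
      using AE_lborel_singleton[of a]
    proof eventually_elim
      case (elim t)
      show ?case
      proof (cases "t \<in> Ioo0 R")
        case True
        have "ennreal (min (\<phi> a / \<phi> t) (\<psi> a / \<psi> t) powr p) * ennreal (w2 t)
            \<le> ennreal (\<psi> a powr p) * ennreal (\<psi> t powr (-p) * w2 t)"
          using mult_right_mono[OF ennreal_leI[OF pw(2)[OF True]], of "ennreal (w2 t)"]
          by (simp add: ennreal_mult' mult.assoc)
        moreover have "ennreal (min (\<phi> a / \<phi> t) (\<psi> a / \<psi> t) powr p) * ennreal (w2 t)
            \<le> ennreal (\<phi> a powr p) * ennreal (\<phi> t powr (-p) * w2 t)"
          using mult_right_mono[OF ennreal_leI[OF pw(1)[OF True]], of "ennreal (w2 t)"]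
          by (simp add: ennreal_mult' mult.assoc)
        ultimately show ?thesis using True elim by (auto simp: Ioo0_def IooR_def indicator_def)
      qed simp
    qed
  qed
  also have "\<dots> = ennreal (\<psi> a powr p) * (\<integral>\<^sup>+ s\<in>{0<..<a}. ennreal (\<psi> s powr (-p) * w2 s) \<partial>lborel)
         + ennreal (\<phi> a powr p) * (\<integral>\<^sup>+ s\<in>IooR a R. ennreal (\<phi> s powr (-p) * w2 s) \<partial>lborel)"
    by (simp add: nn_integral_add nn_integral_cmult)
  also note cond
  also have "(\<integral>\<^sup>+ s\<in>{0<..<a}. ennreal (w1 s) \<partial>lborel)
         + ennreal (a powr p) * (\<integral>\<^sup>+ s\<in>IooR a R. ennreal (s powr (-p) * w1 s) \<partial>lborel)
      = (\<integral>\<^sup>+ s. ennreal (w1 s) * indicator {0<..<a} s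
         + ennreal (a powr p) * (ennreal (s powr (-p) * w1 s) * indicator (IooR a R) s) \<partial>lborel)"
    by (simp add: nn_integral_add nn_integral_cmult)
  also have "\<dots> \<le> (\<integral>\<^sup>+ t\<in>Ioo0 R. ennreal ((min a t / t) powr p) * ennreal (w1 t) \<partial>lborel)"
  proof (rule nn_integral_mono)
    fix t
    consider "0 < t" "t < a" | "t \<in> IooR a R" | "t \<notin> {0<..<a}" "t \<notin> IooR a R" by auto
    then show "ennreal (w1 t) * indicator {0<..<a} t
         + ennreal (a powr p) * (ennreal (t powr (-p) * w1 t) * indicator (IooR a R) t)
       \<le> ennreal ((min a t / t) powr p) * ennreal (w1 t) * indicator (Ioo0 R) t"
    proof cases
      case 1
      then show ?thesis using sub[of t] by (simp add: IooR_def)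
    next
      case 2
      then have t: "a < t" by (simp add: IooR_def)
      have eq: "(a / t) powr p = a powr p * t powr (-p)"
        using t a0 by (simp add: powr_divide powr_minus_divide)
      have "ennreal (a powr p) * ennreal (t powr (-p) * w1 t) = ennreal ((a / t) powr p) * ennreal (w1 t)"
        unfolding eq by (simp add: ennreal_mult' mult.assoc)
      then show ?thesis using 2 t sub'[of t] by simp
    qed auto
  qed
  finally show ?thesis by (simp add: mult_left_mono)
qed

section \<open>From single test functions to superpositions over levels\<close>

context decreasing_density begin

lemma nn_integral_level_length_le:
  assumes "1 \<le> p" "0 \<le> b" "0 < t"
  shows "(\<integral>\<^sup>+ l\<in>{0<..}. ennreal (min (level_length (k p) b l) t powr p) \<partial>lborel) \<le> ennreal (p * F t powr p)"
proof -
  have "(\<integral>\<^sup>+ l\<in>{0<..}. ennreal (min (level_length (k p) b l) t powr p) \<partial>lborel)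
      = ennreal p * (\<integral>\<^sup>+ s\<in>{0<..<min b t}. ennreal (k p s * s powr (p - 1)) \<partial>lborel)"
    using assms by (intro layer_cake k_antimono k_measurable k_nonneg) auto
  also have "\<dots> \<le> ennreal p * (\<integral>\<^sup>+ s\<in>{0<..<t}. ennreal (k p s * s powr (p - 1)) \<partial>lborel)"
    by (intro mult_left_mono nn_integral_mono) (auto simp: indicator_def)
  also have "\<dots> \<le> ennreal p * ennreal (F t powr p)"
    using assms by (intro mult_left_mono nn_integral_k_le) auto
  finally show ?thesis using assms by (simp add: ennreal_mult)
qed

text \<open>The layer-cake integral runs over \<open>(0, min b t)\<close>; with
  \<open>t \<le> b\<close> the cutoff loses nothing and \<open>nn_integral_k_ge\<close>
  applies.\<close>

lemma nn_integral_level_length_ge: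
  assumes "1 \<le> p" "0 < t" "t \<le> b"
  shows "ennreal (p / (2 * 4 powr (p - 1)) * F t powr p)
    \<le> (\<integral>\<^sup>+ l\<in>{0<..}. ennreal (min (level_length (k p) b l) t powr p) \<partial>lborel)"
proof -
  have "ennreal (p / (2 * 4 powr (p - 1)) * F t powr p) = ennreal (p * (F t powr p / (2 * 4 powr (p - 1))))"
    by simp
  also have "\<dots> = ennreal p * ennreal (F t powr p / (2 * 4 powr (p - 1)))"
    using assms by (intro ennreal_mult) auto
  also have "\<dots> \<le> ennreal p * (\<integral>\<^sup>+ s\<in>{0<..<t}. ennreal (k p s * s powr (p - 1)) \<partial>lborel)"
    using assms by (intro mult_left_mono nn_integral_k_ge) auto
  also have "\<dots> = ennreal p * (\<integral>\<^sup>+ s\<in>{0<..<min b t}. ennreal (k p s * s powr (p - 1)) \<partial>lborel)"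
    using assms by (simp add: min_absorb2)
  also have "\<dots> = (\<integral>\<^sup>+ l\<in>{0<..}. ennreal (min (level_length (k p) b l) t powr p) \<partial>lborel)"
    using assms by (intro layer_cake[symmetric] k_antimono k_measurable k_nonneg) auto
  finally show ?thesis .
qed

text \<open>The function \<open>G\<close> stands for the maximal function of \<open>T f\<close>. Its
  \<open>p\<close>-th power is bounded pointwise by superpositions \<open>X n\<close> of test
  functions, whose weighted integrals are compared with that of \<open>(F t / t) powr p\<close>
  level by level; monotone convergence removes the cutoff.\<close>

lemma weighted_inequality:
  fixes G :: "real \<Rightarrow> ennreal"
  assumes [measurable]: "\<phi> \<in> borel_measurable borel" "\<psi> \<in> borel_measurable borel"
      "w1 \<in> borel_measurable borel" "w2 \<in> borel_measurable borel"
    and phi: "quasiconcave R \<phi>" and psi: "quasiconcave R \<psi>" and R: "0 < R"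
    and p: "1 \<le> p" and K: "0 \<le> K" and L: "0 < L"
    and cond: "\<And>a. a \<in> Ioo0 R \<Longrightarrow>
         ennreal (\<psi> a powr p) * (\<integral>\<^sup>+ s\<in>{0<..<a}. ennreal (\<psi> s powr (-p) * w2 s) \<partial>lborel)
         + ennreal (\<phi> a powr p) * (\<integral>\<^sup>+ s\<in>IooR a R. ennreal (\<phi> s powr (-p) * w2 s) \<partial>lborel)
       \<le> ennreal K * ((\<integral>\<^sup>+ s\<in>{0<..<a}. ennreal (w1 s) \<partial>lborel)
         + ennreal (a powr p) * (\<integral>\<^sup>+ s\<in>IooR a R. ennreal (s powr (-p) * w1 s) \<partial>lborel))"
    and G: "\<And>t N. t \<in> Ioo0 R \<Longrightarrow> 0 \<le> N \<Longrightarrow>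
         (\<And>s. s \<in> Ioo0 R \<Longrightarrow> F s / s \<le> N * max (\<phi> t / \<phi> s) (\<psi> t / \<psi> s)) \<Longrightarrow> G t \<le> ennreal (L * N)"
  shows "(\<integral>\<^sup>+ t\<in>Ioo0 R. ennpow (G t) p * ennreal (w2 t) \<partial>lborel)
    \<le> ennreal (L powr p * (2 * 4 powr (p - 1)) * K) * (\<integral>\<^sup>+ t\<in>Ioo0 R. ennreal ((F t / t) powr p) * ennreal (w1 t) \<partial>lborel)"
proof -
  obtain b where b: "incseq b" "\<And>n. b n \<in> Ioo0 R" "\<And>t. t \<in> Ioo0 R \<Longrightarrow> \<exists>n. t \<le> b n"
    using Ioo0_exhaustion[OF R] by blast
  have b0: "0 \<le> b n" for n using b(2)[of n] by (simp add: Ioo0_def)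
  define c where "c = p / (2 * 4 powr (p - 1))"
  have c: "0 < c" using p by (simp add: c_def)
  \<comment> \<open>Cutting at \<open>b n\<close> keeps the level lengths in \<open>[0,R)\<close>,
    where \<phi> and \<psi> are quasiconcave.\<close>
  define A where "A n = level_length (k p) (b n)" for n
  note anti = k_antimono[OF p] and km = k_measurable[of p]
  have [measurable]: "A n \<in> borel_measurable borel" for n
    unfolding A_def by (rule borel_measurable_level_length[OF anti km])
  have A: "A n l = 0 \<or> A n l \<in> Ioo0 R" for n l
    using level_length_nonneg[OF anti km, of "b n" l] level_length_le[OF anti km b0, of n l]
      Ioo0_downward[OF b(2)[of n], of "A n l"] unfolding A_def by linarith
  have A_mono: "A n l \<le> A m l" if "n \<le> m" for n m l
    unfolding A_def using that b(1) by (intro level_length_mono[OF anti km]) (auto simp: incseq_def)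
  have pos: "0 < \<phi> t" "0 < \<psi> t" if "t \<in> Ioo0 R" for t
    using quasiconcave_pos[OF phi that] quasiconcave_pos[OF psi that] by auto
  have mono: "0 \<le> \<phi> (A n l) \<and> \<phi> (A n l) \<le> \<phi> (A m l) \<and> 0 \<le> \<psi> (A n l) \<and> \<psi> (A n l) \<le> \<psi> (A m l)"
    if "n \<le> m" for n m l
  proof -
    have "A n l \<in> Ico0 R" "A m l \<in> Ico0 R"
      using A[of n l] A[of m l] R by (auto simp: Ioo0_def Ico0_def)
    with A_mono[OF that, of l] phi psi show ?thesis
      by (auto simp: quasiconcave_def elim!: mono_onD)
  qed
  define D where "D n l t = min (\<phi> (A n l) / \<phi> t) (\<psi> (A n l) / \<psi> t) powr p" for n l t
  define X where "X n t = (\<integral>\<^sup>+ l\<in>{0<..}. ennreal (D n l t) \<partial>lborel)" for n t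
  have X_mono: "X n t \<le> X m t" if "n \<le> m" "t \<in> Ioo0 R" for n m t
    unfolding X_def
  proof (rule nn_integral_mono)
    fix l
    have "D n l t \<le> D m l t"
      unfolding D_def using mono[OF that(1), of l] pos[OF that(2)] p
      by (intro powr_mono2 min.mono divide_right_mono) auto
    then show "ennreal (D n l t) * indicator {0<..} l \<le> ennreal (D m l t) * indicator {0<..} l"
      by (auto simp: indicator_def intro: ennreal_leI)
  qed
  have [measurable]: "X n \<in> borel_measurable borel" for n
    unfolding X_def D_def by measurable

  have pointwise: "ennpow (G t) p \<le> ennreal (L powr p / c) * (SUP n. X n t)" if t: "t \<in> Ioo0 R" for t
  proof (cases "SUP n. X n t")
    case top
    show ?thesis unfolding top using L c by (simp add: ennreal_mult_top)
  next
    case (real x)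
    \<comment> \<open>Solves \<open>c * N powr p = x\<close>, with \<open>c\<close> the constant
      lost in \<open>nn_integral_level_length_ge\<close>.\<close>
    define N where "N = (x / c) powr (1 / p)"
    have Np: "N powr p = x / c" using real c p by (simp add: N_def powr_powr)
    have "G t \<le> ennreal (L * N)"
    proof (rule G[OF t])
      show "0 \<le> N" by (simp add: N_def)
      fix s assume s: "s \<in> Ioo0 R"
      then have s0: "0 < s" by (simp add: Ioo0_def)
      define m where "m = max (\<phi> t / \<phi> s) (\<psi> t / \<psi> s)"
      have m: "0 \<le> m" using pos[OF s] pos[OF t] by (simp add: m_def le_max_iff_disj)
      \<comment> \<open>The cutoff must not lie before \<open>s\<close>, so \<open>n\<close> depends
        on \<open>s\<close>; this is why \<open>N\<close> is built from the supremum over all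
        \<open>n\<close>.\<close>
      obtain n where n: "s \<le> b n" using b(3)[OF s] by auto
      have "ennreal (c * F s powr p) \<le> (\<integral>\<^sup>+ l\<in>{0<..}. ennreal (min (A n l) s powr p) \<partial>lborel)"
        unfolding c_def A_def using nn_integral_level_length_ge[OF p s0 n] by simp
      also have "\<dots> \<le> (\<integral>\<^sup>+ l. ennreal ((s * m) powr p) * (ennreal (D n l t) * indicator {0<..} l) \<partial>lborel)"
      proof (rule nn_integral_mono)
        fix l
        have An: "0 \<le> A n l" using A[of n l] by (auto simp: Ioo0_def)
        have "min (A n l) s / s \<le> m * min (\<phi> (A n l) / \<phi> t) (\<psi> (A n l) / \<psi> t)"
          unfolding m_def by (rule min_scale_le_min_max[OF phi psi R s t A])
        then have "min (A n l) s \<le> (s * m) * min (\<phi> (A n l) / \<phi> t) (\<psi> (A n l) / \<psi> t)"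
          using s0 by (simp add: pos_divide_le_eq mult_ac)
        then have "min (A n l) s powr p \<le> ((s * m) * min (\<phi> (A n l) / \<phi> t) (\<psi> (A n l) / \<psi> t)) powr p"
          using p An s0 by (intro powr_mono2) auto
        also have "\<dots> = (s * m) powr p * D n l t"
          unfolding D_def by (rule powr_mult)
        finally have "ennreal (min (A n l) s powr p) \<le> ennreal ((s * m) powr p) * ennreal (D n l t)"
          by (simp add: ennreal_leI D_def flip: ennreal_mult)
        then show "ennreal (min (A n l) s powr p) * indicator {0<..} l
            \<le> ennreal ((s * m) powr p) * (ennreal (D n l t) * indicator {0<..} l)"
          by (auto simp: indicator_def)
      qed
      also have "\<dots> = ennreal ((s * m) powr p) * X n t"
        unfolding X_def D_def by (rule nn_integral_cmult) measurable
      also have "\<dots> \<le> ennreal ((s * m) powr p) * ennreal x"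
        unfolding real(2)[symmetric] by (intro mult_left_mono SUP_upper) auto
      finally have "ennreal (c * F s powr p) \<le> ennreal ((s * m) powr p * x)"
        using real by (simp add: ennreal_mult)
      then have "c * F s powr p \<le> (s * m) powr p * x" using real by simp
      then have "F s powr p \<le> (s * m) powr p * (x / c)" using c by (simp add: field_simps)
      also have "\<dots> = (s * m * N) powr p"
        by (simp add: Np powr_mult)
      finally have "F s \<le> s * m * N"
        using p s0 m F_nonneg[of s] powr_less_mono2[of p "s * m * N" "F s"]
        by (force simp: N_def not_le[symmetric])
      then show "F s / s \<le> N * max (\<phi> t / \<phi> s) (\<psi> t / \<psi> s)"
        using s0 by (simp add: m_def pos_divide_le_eq mult_ac)
    qed
    then have "ennpow (G t) p \<le> ennpow (ennreal (L * N)) p" using p by (intro ennpow_mono) auto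
    also have "\<dots> = ennreal (L powr p / c * x)"
      using L Np by (simp add: ennpow_ennreal powr_mult N_def)
    also have "\<dots> = ennreal (L powr p / c) * (SUP n. X n t)"
      unfolding real(2) using real(1) L c by (intro ennreal_mult) auto
    finally show ?thesis .
  qed

  \<comment> \<open>Fubini is used twice. With the level fixed, \<open>cond\<close> at
    \<open>a = A n l\<close> compares the two test functions; with \<open>t\<close> fixed, the upper
    bound for level lengths gives back \<open>p * F t powr p\<close>.\<close>
  have step: "(\<integral>\<^sup>+ t\<in>Ioo0 R. X n t * ennreal (w2 t) \<partial>lborel)
      \<le> ennreal (K * p) * (\<integral>\<^sup>+ t\<in>Ioo0 R. ennreal ((F t / t) powr p) * ennreal (w1 t) \<partial>lborel)" for n
  proof -
    have "(\<integral>\<^sup>+ t\<in>Ioo0 R. X n t * ennreal (w2 t) \<partial>lborel)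
        = (\<integral>\<^sup>+ t. (\<integral>\<^sup>+ l. ennreal (D n l t) * indicator {0<..} l * (ennreal (w2 t) * indicator (Ioo0 R) t) \<partial>lborel) \<partial>lborel)"
      unfolding X_def D_def
      by (intro nn_integral_cong, subst nn_integral_multc) (auto simp: mult.assoc)
    also have "\<dots> = (\<integral>\<^sup>+ l. (\<integral>\<^sup>+ t. ennreal (D n l t) * indicator {0<..} l * (ennreal (w2 t) * indicator (Ioo0 R) t) \<partial>lborel) \<partial>lborel)"
      by (rule lborel_pair.Fubini') (unfold D_def, measurable)
    also have "\<dots> \<le> (\<integral>\<^sup>+ l. (\<integral>\<^sup>+ t. ennreal K * (ennreal ((min (A n l) t / t) powr p) * indicator {0<..} l * (ennreal (w1 t) * indicator (Ioo0 R) t)) \<partial>lborel) \<partial>lborel)"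
    proof (rule nn_integral_mono)
      fix l
      have "(\<integral>\<^sup>+ t\<in>Ioo0 R. ennreal (D n l t) * ennreal (w2 t) \<partial>lborel)
          \<le> ennreal K * (\<integral>\<^sup>+ t\<in>Ioo0 R. ennreal ((min (A n l) t / t) powr p) * ennreal (w1 t) \<partial>lborel)"
      proof (cases "A n l = 0")
        case True
        \<comment> \<open>\<open>test_function_inequality\<close> needs \<open>a\<close> inside
          \<open>(0,R)\<close>; at \<open>a = 0\<close> the test function vanishes because \<phi>
          and \<psi> do.\<close>
        have "D n l t = 0" if "t \<in> Ioo0 R" for t
          using True quasiconcave_zero[OF R phi] quasiconcave_zero[OF R psi] by (simp add: D_def)
        then have "(\<integral>\<^sup>+ t\<in>Ioo0 R. ennreal (D n l t) * ennreal (w2 t) \<partial>lborel) = (\<integral>\<^sup>+ t. 0 \<partial>(lborel :: real measure))"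
          by (intro nn_integral_cong) (auto simp: indicator_def)
        then show ?thesis by simp
      next
        case False
        then have "A n l \<in> Ioo0 R" using A by blast
        then show ?thesis
          unfolding D_def using p by (intro test_function_inequality phi psi cond) auto
      qed
      then have "(\<integral>\<^sup>+ t. ennreal (D n l t) * (ennreal (w2 t) * indicator (Ioo0 R) t) \<partial>lborel)
          \<le> (\<integral>\<^sup>+ t. ennreal K * (ennreal ((min (A n l) t / t) powr p) * (ennreal (w1 t) * indicator (Ioo0 R) t)) \<partial>lborel)"
        by (simp add: nn_integral_cmult mult.assoc)
      then show "(\<integral>\<^sup>+ t. ennreal (D n l t) * indicator {0<..} l * (ennreal (w2 t) * indicator (Ioo0 R) t) \<partial>lborel)
          \<le> (\<integral>\<^sup>+ t. ennreal K * (ennreal ((min (A n l) t / t) powr p) * indicator {0<..} l * (ennreal (w1 t) * indicator (Ioo0 R) t)) \<partial>lborel)"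
        by (cases "0 < l") simp_all
    qed
    also have "\<dots> = (\<integral>\<^sup>+ t. (\<integral>\<^sup>+ l. ennreal K * (ennreal ((min (A n l) t / t) powr p) * indicator {0<..} l * (ennreal (w1 t) * indicator (Ioo0 R) t)) \<partial>lborel) \<partial>lborel)"
      by (rule lborel_pair.Fubini') measurable
    also have "\<dots> \<le> (\<integral>\<^sup>+ t. ennreal (K * p) * (ennreal ((F t / t) powr p) * ennreal (w1 t) * indicator (Ioo0 R) t) \<partial>lborel)"
    proof (rule nn_integral_mono)
      fix t
      show "(\<integral>\<^sup>+ l. ennreal K * (ennreal ((min (A n l) t / t) powr p) * indicator {0<..} l * (ennreal (w1 t) * indicator (Ioo0 R) t)) \<partial>lborel)
          \<le> ennreal (K * p) * (ennreal ((F t / t) powr p) * ennreal (w1 t) * indicator (Ioo0 R) t)"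
      proof (cases "t \<in> Ioo0 R")
        case True
        then have t: "0 < t" by (simp add: Ioo0_def)
        have An: "0 \<le> A n l" for l using A[of n l] by (auto simp: Ioo0_def)
        have "(\<integral>\<^sup>+ l. ennreal K * (ennreal ((min (A n l) t / t) powr p) * indicator {0<..} l * (ennreal (w1 t) * indicator (Ioo0 R) t)) \<partial>lborel)
            = (\<integral>\<^sup>+ l. (ennreal (K / t powr p) * ennreal (w1 t)) * (ennreal (min (A n l) t powr p) * indicator {0<..} l) \<partial>lborel)"
        proof (rule nn_integral_cong)
          fix l
          have eq: "ennreal K * ennreal ((min (A n l) t / t) powr p) = ennreal (K / t powr p) * ennreal (min (A n l) t powr p)"
            using K t An[of l] by (simp add: powr_divide flip: ennreal_mult)
          have "ennreal K * (ennreal ((min (A n l) t / t) powr p) * indicator {0<..} l * (ennreal (w1 t) * indicator (Ioo0 R) t))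
            = (ennreal K * ennreal ((min (A n l) t / t) powr p)) * (ennreal (w1 t) * indicator {0<..} l * indicator (Ioo0 R) t)"
            by (simp only: mult_ac)
          also have "\<dots> = (ennreal (K / t powr p) * ennreal (w1 t)) * (ennreal (min (A n l) t powr p) * indicator {0<..} l)"
            unfolding eq using True by (simp add: mult_ac)
          finally show "ennreal K * (ennreal ((min (A n l) t / t) powr p) * indicator {0<..} l * (ennreal (w1 t) * indicator (Ioo0 R) t))
            = (ennreal (K / t powr p) * ennreal (w1 t)) * (ennreal (min (A n l) t powr p) * indicator {0<..} l)" .
        qed
        also have "\<dots> = (ennreal (K / t powr p) * ennreal (w1 t)) * (\<integral>\<^sup>+ l\<in>{0<..}. ennreal (min (A n l) t powr p) \<partial>lborel)"
          by (rule nn_integral_cmult) measurable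
        also have "\<dots> \<le> (ennreal (K / t powr p) * ennreal (w1 t)) * ennreal (p * F t powr p)"
          unfolding A_def using p t b0 by (intro mult_left_mono nn_integral_level_length_le) auto
        also have "\<dots> = (ennreal (K / t powr p) * ennreal (p * F t powr p)) * ennreal (w1 t)"
          by (simp only: mult_ac)
        also have "ennreal (K / t powr p) * ennreal (p * F t powr p) = ennreal (K * p) * ennreal ((F t / t) powr p)"
          using K t p F_nonneg[of t] by (simp add: powr_divide flip: ennreal_mult)
        finally show ?thesis using True by (simp add: mult.assoc)
      qed simp
    qed
    also have "\<dots> = ennreal (K * p) * (\<integral>\<^sup>+ t\<in>Ioo0 R. ennreal ((F t / t) powr p) * ennreal (w1 t) \<partial>lborel)"
      by (rule nn_integral_cmult) measurable
    finally show ?thesis .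
  qed

  have "(\<integral>\<^sup>+ t\<in>Ioo0 R. ennpow (G t) p * ennreal (w2 t) \<partial>lborel)
      \<le> (\<integral>\<^sup>+ t. ennreal (L powr p / c) * (SUP n. X n t * ennreal (w2 t) * indicator (Ioo0 R) t) \<partial>lborel)"
  proof (rule nn_integral_mono)
    fix t
    show "ennpow (G t) p * ennreal (w2 t) * indicator (Ioo0 R) t
        \<le> ennreal (L powr p / c) * (SUP n. X n t * ennreal (w2 t) * indicator (Ioo0 R) t)"
      using mult_right_mono[OF pointwise[of t], of "ennreal (w2 t)"]
      by (auto simp: indicator_def mult.assoc SUP_mult_right_ennreal)
  qed
  also have "\<dots> = ennreal (L powr p / c) * (\<integral>\<^sup>+ t. (SUP n. X n t * ennreal (w2 t) * indicator (Ioo0 R) t) \<partial>lborel)"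
    by (rule nn_integral_cmult) measurable
  also have "(\<integral>\<^sup>+ t. (SUP n. X n t * ennreal (w2 t) * indicator (Ioo0 R) t) \<partial>lborel)
      = (SUP n. \<integral>\<^sup>+ t. X n t * ennreal (w2 t) * indicator (Ioo0 R) t \<partial>lborel)"
  proof (rule nn_integral_monotone_convergence_SUP)
    show "incseq (\<lambda>n t. X n t * ennreal (w2 t) * indicator (Ioo0 R) t)"
      by (auto simp: incseq_def le_fun_def indicator_def intro!: mult_right_mono X_mono)
  qed measurable
  also have "ennreal (L powr p / c) * \<dots>
      \<le> ennreal (L powr p / c) * (ennreal (K * p) * (\<integral>\<^sup>+ t\<in>Ioo0 R. ennreal ((F t / t) powr p) * ennreal (w1 t) \<partial>lborel))"
    by (intro mult_left_mono SUP_least step) auto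
  also have "\<dots> = (ennreal (L powr p / c) * ennreal (K * p)) * (\<integral>\<^sup>+ t\<in>Ioo0 R. ennreal ((F t / t) powr p) * ennreal (w1 t) \<partial>lborel)"
    by (simp only: mult.assoc)
  also have "ennreal (L powr p / c) * ennreal (K * p) = ennreal (L powr p / c * (K * p))"
    using c K p by (intro ennreal_mult[symmetric]) auto
  \<comment> \<open>The factor \<open>p\<close> from the upper level-length bound cancels the one
    contained in \<open>c\<close>.\<close>
  also have "L powr p / c * (K * p) = L powr p * (2 * 4 powr (p - 1)) * K"
    using p by (simp add: c_def)
  finally show ?thesis .
qed

end

subsection \<open>Boundedness on Lorentz gamma spaces\<close>

text \<open>Local integrability gives measurability on compact subintervals; the intervals
  \<open>[1 / (n + 1), b n]\<close> exhaust \<open>(0,R)\<close>, and pointwise limits stay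
  Borel.\<close>

lemma weight_borel_measurable:
  assumes R: "0 < R" and w: "weight R w"
  shows "(\<lambda>s. w s * indicator (Ioo0 R) s) \<in> borel_measurable borel"
proof -
  obtain b where b: "incseq b" "\<And>n. b n \<in> Ioo0 R" "\<And>t. t \<in> Ioo0 R \<Longrightarrow> \<exists>n. t \<le> b n"
    using Ioo0_exhaustion[OF R] by blast
  let ?S = "\<lambda>n. {1 / real (Suc n)..b n}"
  show ?thesis
  proof (rule borel_measurable_LIMSEQ_real)
    fix n
    \<comment> \<open>The interval may be empty for small \<open>n\<close>, a case on which local
      integrability says nothing.\<close>
    have "set_integrable lborel (?S n) w"
    proof (cases "1 / real (Suc n) \<le> b n")
      case True
      then show ?thesis using w b(2)[of n] unfolding weight_def Ioo0_def by auto
    next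
      case False
      then have "?S n = {}" by simp
      then show ?thesis by (simp only:) simp
    qed
    then have "(\<lambda>s. indicator (?S n) s *\<^sub>R w s) \<in> borel_measurable borel"
      unfolding set_integrable_def by (auto dest: borel_measurable_integrable)
    then show "(\<lambda>s. w s * indicator (?S n) s) \<in> borel_measurable borel" by (simp add: mult.commute)
  next
    fix s
    show "(\<lambda>n. w s * indicator (?S n) s) \<longlonglongrightarrow> w s * indicator (Ioo0 R) s"
    proof (cases "s \<in> Ioo0 R")
      case True
      then have "0 < s" by (simp add: Ioo0_def)
      then obtain m where m: "1 / real (Suc m) < s" by (rule nat_approx_posE)
      obtain j where j: "s \<le> b j" using b(3)[OF True] by auto
      have "eventually (\<lambda>n. w s * indicator (?S n) s = w s * indicator (Ioo0 R) s) sequentially"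
        using eventually_ge_at_top[of "max m j"]
      proof eventually_elim
        case (elim n)
        then have "1 / real (Suc n) \<le> 1 / real (Suc m)" by (simp add: frac_le)
        moreover have "b j \<le> b n" using b(1) elim by (simp add: incseq_def)
        ultimately have "s \<in> ?S n" using m j by simp
        then show ?case using True by simp
      qed
      then show ?thesis by (rule tendsto_eventually)
    next
      case False
      have "s \<notin> ?S n" for n
      proof
        assume "s \<in> ?S n"
        then have "1 / real (Suc n) \<le> s" "s \<le> b n" by auto
        moreover have "0 < 1 / real (Suc n)" by simp
        ultimately have "0 < s" "s \<le> b n" by linarith+
        then show False using False Ioo0_downward[OF b(2)[of n]] by blast
      qed
      with False show ?thesis by simp
    qed
  qed
qed

lemma quasiconcave_borel_measurable:
  assumes "quasiconcave R \<phi>"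
  shows "(\<lambda>s. \<phi> s * indicator (Ico0 R) s) \<in> borel_measurable borel"
proof -
  have "{t \<in> space borel. 0 \<le> t \<and> ennreal t < R} \<in> sets borel" by measurable
  then have [measurable]: "Ico0 R \<in> sets borel" by (simp add: Ico0_def)
  have "\<phi> \<in> borel_measurable (restrict_space borel (Ico0 R))"
    using assms by (intro borel_measurable_mono_on_fnc) (simp add: quasiconcave_def)
  then show ?thesis
    by (simp add: borel_measurable_restrict_space_iff mult.commute)
qed

lemma quasiconcave_cong:
  assumes "\<And>t. t \<in> Ico0 R \<Longrightarrow> \<phi> t = \<psi> t"
  shows "quasiconcave R \<phi> \<longleftrightarrow> quasiconcave R \<psi>"
proof -
  have "t \<in> Ico0 R" if "t \<in> Ioo0 R" for t using that by (simp add: Ioo0_def Ico0_def)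
  then show ?thesis using assms by (simp add: quasiconcave_def monotone_on_def)
qed

section \<open>The rearrangement as a real-valued non-increasing density\<close>

lemma drearr_eq_0:
  assumes "emeasure M (space M) \<le> ennreal t"
  shows "drearr M f t = 0"
proof -
  have "drearr M f t \<le> 0"
  proof (rule drearr_leI)
    fix l' :: ennreal
    have "emeasure M {x \<in> space M. l' < ennreal \<bar>f x\<bar>} \<le> emeasure M (space M)"
      by (rule emeasure_space)
    then show "emeasure M {x \<in> space M. l' < ennreal \<bar>f x\<bar>} \<le> ennreal t" using assms by order
  qed
  then show ?thesis by simp
qed

context
  fixes R :: ennreal and M :: "'a measure" and f :: "'a \<Rightarrow> real" and w :: "real \<Rightarrow> real"
  assumes R: "0 < R" and M: "emeasure M (space M) = R"
    and fin: "\<And>s. s \<in> Ioo0 R \<Longrightarrow> maxrearr M f s < \<infinity>"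
  defines "w \<equiv> \<lambda>s. enn2real (drearr M f s) * indicator {0<..} s"
begin

text \<open>Below \<open>R\<close> finiteness comes from the maximal function, which dominates the
  rearrangement; from \<open>R\<close> on the rearrangement vanishes.\<close>

lemma ennreal_real_drearr: "0 < s \<Longrightarrow> ennreal (w s) = drearr M f s"
proof -
  assume s: "0 < s"
  have "drearr M f s < \<infinity>"
  proof (cases "s \<in> Ioo0 R")
    case True
    then show ?thesis using drearr_le_maxrearr[OF s, of M f] fin[OF True] by order
  next
    case False
    then have "emeasure M (space M) \<le> ennreal s" using s M by (auto simp: Ioo0_def)
    then show ?thesis by (simp add: drearr_eq_0)
  qed
  then show ?thesis using s by (simp add: w_def ennreal_enn2real_if)
qed

lemma nn_integral_real_drearr:
  "(\<integral>\<^sup>+ s\<in>{0<..<t}. ennreal (w s) \<partial>lborel) = (\<integral>\<^sup>+ s\<in>{0<..<t}. drearr M f s \<partial>lborel)"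
  by (intro nn_integral_cong) (auto simp: indicator_def ennreal_real_drearr)

lemma decreasing_density_drearr: "decreasing_density w"
proof
  show "w \<in> borel_measurable borel" unfolding w_def by measurable
  show "0 \<le> w s" for s by (simp add: w_def)
  show "antimono_on {0<..} w"
  proof (rule monotone_onI)
    fix s t :: real assume st: "s \<in> {0<..}" "t \<in> {0<..}" "s \<le> t"
    have "ennreal (w t) \<le> ennreal (w s)"
      using st by (simp add: ennreal_real_drearr antimonoD[OF antimono_drearr])
    then show "w t \<le> w s" by (simp add: w_def)
  qed
  fix t :: real assume t: "0 < t"
  obtain b :: "nat \<Rightarrow> real" where b: "\<And>n. b n \<in> Ioo0 R"
    using Ioo0_exhaustion[OF R] by blast
  \<comment> \<open>\<open>t\<close> may lie beyond \<open>R\<close>, whereas the maximal function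
    is known to be finite inside \<open>(0,R)\<close>. The scaling inequality transfers finiteness
    from \<open>s\<close> to \<open>t\<close>.\<close>
  define s where "s = min (b 0) t"
  have "0 < b 0" using b[of 0] by (simp add: Ioo0_def)
  then have s: "0 < s" "s \<le> t" using t by (auto simp: s_def)
  have sR: "s \<in> Ioo0 R" using Ioo0_downward[OF b[of 0] s(1)] by (simp add: s_def)
  have "(\<integral>\<^sup>+ s\<in>{0<..<t}. drearr M f s \<partial>lborel)
      \<le> ennreal (t / s) * (\<integral>\<^sup>+ s\<in>{0<..<s}. drearr M f s \<partial>lborel)"
    using s antimono_drearr[of M f]
    by (intro nn_integral_antimono_scale) (auto intro: monotone_on_subset)
  also have "\<dots> < \<infinity>"
    using fin[OF sR] s by (simp add: nn_integral_drearr_eq ennreal_mult_less_top)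
  finally show "(\<integral>\<^sup>+ s\<in>{0<..<t}. ennreal (w s) \<partial>lborel) < \<infinity>"
    by (simp only: nn_integral_real_drearr)
qed

lemma primitive_drearr:
  assumes t: "t \<in> Ioo0 R"
  shows "maxrearr M f t = ennreal (decreasing_density.F w t / t)"
proof -
  interpret decreasing_density w by (rule decreasing_density_drearr)
  have t0: "0 < t" using t by (simp add: Ioo0_def)
  have "ennreal (F t) / ennreal t = maxrearr M f t"
    by (simp only: ennreal_F nn_integral_real_drearr maxrearr_def)
  then show ?thesis using t0 by (simp add: divide_ennreal F_nonneg)
qed

end

text \<open>For \<open>y = 0\<close> a finite quotient forces \<open>x = 0\<close>; for
  \<open>y = \<infinity>\<close> the right side is infinite because \<open>K\<close> is
  positive.\<close>

lemma ennreal_le_mult_if_divide_le: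
  fixes x y :: ennreal
  assumes "x / y \<le> ennreal K" "0 < K"
  shows "x \<le> ennreal K * y"
proof (cases "y = 0 \<or> y = \<infinity>")
  case True
  then show ?thesis using assms by (auto simp: ennreal_mult_top top_unique split: if_splits)
next
  case False
  then have "x = x / y * y" by (simp add: ennreal_divide_times less_top)
  also have "\<dots> \<le> ennreal K * y" by (intro mult_right_mono assms) simp
  finally show ?thesis .
qed

theorem theorem1p2:
  fixes R :: ennreal and M1 :: "'a measure" and M2 :: "'b measure"
    and \<phi> \<psi> \<phi>1 \<phi>2 :: "real \<Rightarrow> real" and p :: real
    and T :: "('a \<Rightarrow> real) \<Rightarrow> ('b \<Rightarrow> real)"
  assumes R_pos: "0 < R"
    and sf1: "sigma_finite_measure M1" and sf2: "sigma_finite_measure M2"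
    and na1: "nonatomic M1" and na2: "nonatomic M2"
    and meas1: "emeasure M1 (space M1) = R" and meas2: "emeasure M2 (space M2) = R"
    and qc_phi: "quasiconcave R \<phi>" and qc_psi: "quasiconcave R \<psi>"
    and B_phi: "B_condition R \<phi>" and B_psi: "B_condition R \<psi>"
    and p: "1 \<le> p"
    and w1: "nontrivial_weight R p \<phi>1" and w2: "nontrivial_weight R p \<phi>2"
    and discont: "\<not> continuous_on (Ico0 R) \<phi> \<Longrightarrow>
        (\<exists>L>0. ((\<lambda>t. ennreal (t powr p) *
              (\<integral>\<^sup>+ s\<in>IooR t R. ennreal (s powr (-p) * \<phi>1 s) \<partial>lborel)) \<longlongrightarrow> L) (at_right 0))
        \<and> (\<integral>\<^sup>+ s\<in>Ioo0 R. ennreal (\<phi> s powr (-p) * \<phi>2 s) \<partial>lborel) < \<infinity>"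
    and emb1: "M_space R \<phi> M1 \<inter> M_space R \<psi> M1 \<subseteq> Gamma_space R p \<phi>1 M1"
              "Gamma_space R p \<phi>1 M1 \<subseteq> fun_set_plus (M_space R \<phi> M1) (M_space R \<psi> M1)"
    and emb2: "M_space R \<phi> M2 \<inter> M_space R \<psi> M2 \<subseteq> Gamma_space R p \<phi>2 M2"
              "Gamma_space R p \<phi>2 M2 \<subseteq> fun_set_plus (M_space R \<phi> M2) (M_space R \<psi> M2)"
    and ql: "quasilinear M1 M2 (fun_set_plus (M_space R \<phi> M1) (M_space R \<psi> M1)) T"
    and T_phi: "bounded_op (M_space R \<phi> M1) (M_norm R \<phi> M1) (M_space R \<phi> M2) (M_norm R \<phi> M2) T"
    and T_psi: "bounded_op (M_space R \<psi> M1) (M_norm R \<psi> M1) (M_space R \<psi> M2) (M_norm R \<psi> M2) T"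
    and sup_cond: "(SUP t\<in>Ioo0 R.
        (ennreal (\<psi> t powr p) * (\<integral>\<^sup>+ s\<in>{0<..<t}. ennreal (\<psi> s powr (-p) * \<phi>2 s) \<partial>lborel)
         + ennreal (\<phi> t powr p) * (\<integral>\<^sup>+ s\<in>IooR t R. ennreal (\<phi> s powr (-p) * \<phi>2 s) \<partial>lborel))
        / ((\<integral>\<^sup>+ s\<in>{0<..<t}. ennreal (\<phi>1 s) \<partial>lborel)
         + ennreal (t powr p) * (\<integral>\<^sup>+ s\<in>IooR t R. ennreal (s powr (-p) * \<phi>1 s) \<partial>lborel))) < \<infinity>"
  shows "bounded_op (Gamma_space R p \<phi>1 M1) (Gamma_norm R p \<phi>1 M1)
                    (Gamma_space R p \<phi>2 M2) (Gamma_norm R p \<phi>2 M2) T"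
proof -
  let ?D = "fun_set_plus (M_space R \<phi> M1) (M_space R \<psi> M1)"
  obtain L where L: "0 < L"
    "\<And>f t N. f \<in> ?D \<Longrightarrow> t \<in> Ioo0 R \<Longrightarrow> 0 \<le> N \<Longrightarrow>
       (\<And>s. s \<in> Ioo0 R \<Longrightarrow> maxrearr M1 f s \<le> ennreal (N * max (\<phi> t / \<phi> s) (\<psi> t / \<psi> s))) \<Longrightarrow>
       maxrearr M2 (T f) t \<le> ennreal (L * N)"
    using quasilinear_pointwise_bound[OF qc_phi qc_psi B_phi B_psi ql T_phi T_psi] by blast
  \<comment> \<open>Only the values on \<open>(0, R)\<close> are constrained, so extend by zero to get Borel functions on the line.\<close>
  define \<phi>' where "\<phi>' s = \<phi> s * indicator (Ico0 R) s" for s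
  define \<psi>' where "\<psi>' s = \<psi> s * indicator (Ico0 R) s" for s
  define v1 where "v1 s = \<phi>1 s * indicator (Ioo0 R) s" for s
  define v2 where "v2 s = \<phi>2 s * indicator (Ioo0 R) s" for s
  have wts: "weight R \<phi>1" "weight R \<phi>2" using w1 w2 by (auto simp: nontrivial_weight_def)
  have meas: "\<phi>' \<in> borel_measurable borel" "\<psi>' \<in> borel_measurable borel"
      "v1 \<in> borel_measurable borel" "v2 \<in> borel_measurable borel"
    unfolding \<phi>'_def \<psi>'_def v1_def v2_def
    by (rule quasiconcave_borel_measurable[OF qc_phi] quasiconcave_borel_measurable[OF qc_psi]
        weight_borel_measurable[OF R_pos wts(1)] weight_borel_measurable[OF R_pos wts(2)])+
  have qc': "quasiconcave R \<phi>'" "quasiconcave R \<psi>'"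
    using qc_phi qc_psi quasiconcave_cong[of R \<phi>' \<phi>] quasiconcave_cong[of R \<psi>' \<psi>]
    by (auto simp: \<phi>'_def \<psi>'_def)
  have eq: "\<phi>' s = \<phi> s" "\<psi>' s = \<psi> s" "v1 s = \<phi>1 s" "v2 s = \<phi>2 s" if "s \<in> Ioo0 R" for s
    using that by (auto simp: \<phi>'_def \<psi>'_def v1_def v2_def Ioo0_def Ico0_def)

  define S where "S = (SUP t\<in>Ioo0 R.
        (ennreal (\<psi> t powr p) * (\<integral>\<^sup>+ s\<in>{0<..<t}. ennreal (\<psi> s powr (-p) * \<phi>2 s) \<partial>lborel)
         + ennreal (\<phi> t powr p) * (\<integral>\<^sup>+ s\<in>IooR t R. ennreal (\<phi> s powr (-p) * \<phi>2 s) \<partial>lborel))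
        / ((\<integral>\<^sup>+ s\<in>{0<..<t}. ennreal (\<phi>1 s) \<partial>lborel)
         + ennreal (t powr p) * (\<integral>\<^sup>+ s\<in>IooR t R. ennreal (s powr (-p) * \<phi>1 s) \<partial>lborel)))"
  \<comment> \<open>The added 1 makes \<open>K\<close> positive, as clearing the denominators with
    \<open>ennreal_le_mult_if_divide_le\<close> requires.\<close>
  define K where "K = enn2real S + 1"
  have K: "0 < K" by (simp add: K_def add_nonneg_pos)
  have "S < \<infinity>" unfolding S_def by (rule sup_cond)
  then have SK: "S \<le> ennreal K" by (cases S) (auto simp: K_def simp flip: ennreal_plus)
  have cond: "ennreal (\<psi>' a powr p) * (\<integral>\<^sup>+ s\<in>{0<..<a}. ennreal (\<psi>' s powr (-p) * v2 s) \<partial>lborel)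
         + ennreal (\<phi>' a powr p) * (\<integral>\<^sup>+ s\<in>IooR a R. ennreal (\<phi>' s powr (-p) * v2 s) \<partial>lborel)
       \<le> ennreal K * ((\<integral>\<^sup>+ s\<in>{0<..<a}. ennreal (v1 s) \<partial>lborel)
         + ennreal (a powr p) * (\<integral>\<^sup>+ s\<in>IooR a R. ennreal (s powr (-p) * v1 s) \<partial>lborel))"
    if a: "a \<in> Ioo0 R" for a
  proof -
    have sub: "s \<in> Ioo0 R" if "0 < s" "s < a" for s using Ioo0_downward[OF a, of s] that by simp
    have sub': "s \<in> Ioo0 R" if "s \<in> IooR a R" for s using that a by (simp add: Ioo0_def IooR_def)
    have "(\<integral>\<^sup>+ s\<in>{0<..<a}. ennreal (\<psi>' s powr (-p) * v2 s) \<partial>lborel) = (\<integral>\<^sup>+ s\<in>{0<..<a}. ennreal (\<psi> s powr (-p) * \<phi>2 s) \<partial>lborel)"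
      "(\<integral>\<^sup>+ s\<in>{0<..<a}. ennreal (v1 s) \<partial>lborel) = (\<integral>\<^sup>+ s\<in>{0<..<a}. ennreal (\<phi>1 s) \<partial>lborel)"
      using sub by (auto intro!: nn_integral_cong simp: indicator_def eq)
    moreover have "(\<integral>\<^sup>+ s\<in>IooR a R. ennreal (\<phi>' s powr (-p) * v2 s) \<partial>lborel) = (\<integral>\<^sup>+ s\<in>IooR a R. ennreal (\<phi> s powr (-p) * \<phi>2 s) \<partial>lborel)"
      "(\<integral>\<^sup>+ s\<in>IooR a R. ennreal (s powr (-p) * v1 s) \<partial>lborel) = (\<integral>\<^sup>+ s\<in>IooR a R. ennreal (s powr (-p) * \<phi>1 s) \<partial>lborel)"
      using sub' by (auto intro!: nn_integral_cong simp: indicator_def eq)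
    moreover have "ennreal (\<psi> a powr p) * (\<integral>\<^sup>+ s\<in>{0<..<a}. ennreal (\<psi> s powr (-p) * \<phi>2 s) \<partial>lborel)
         + ennreal (\<phi> a powr p) * (\<integral>\<^sup>+ s\<in>IooR a R. ennreal (\<phi> s powr (-p) * \<phi>2 s) \<partial>lborel)
       \<le> ennreal K * ((\<integral>\<^sup>+ s\<in>{0<..<a}. ennreal (\<phi>1 s) \<partial>lborel)
         + ennreal (a powr p) * (\<integral>\<^sup>+ s\<in>IooR a R. ennreal (s powr (-p) * \<phi>1 s) \<partial>lborel))"
    proof (rule ennreal_le_mult_if_divide_le[OF order_trans[OF _ SK] K])
      show "(ennreal (\<psi> a powr p) * (\<integral>\<^sup>+ s\<in>{0<..<a}. ennreal (\<psi> s powr (-p) * \<phi>2 s) \<partial>lborel)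
         + ennreal (\<phi> a powr p) * (\<integral>\<^sup>+ s\<in>IooR a R. ennreal (\<phi> s powr (-p) * \<phi>2 s) \<partial>lborel))
        / ((\<integral>\<^sup>+ s\<in>{0<..<a}. ennreal (\<phi>1 s) \<partial>lborel)
         + ennreal (a powr p) * (\<integral>\<^sup>+ s\<in>IooR a R. ennreal (s powr (-p) * \<phi>1 s) \<partial>lborel)) \<le> S"
        unfolding S_def using a by (rule SUP_upper)
    qed
    ultimately show ?thesis by (simp only: eq[OF a])
  qed

  \<comment> \<open>The constant of \<open>weighted_inequality\<close>; the root in the Gamma norm
    turns it into \<open>C powr (1 / p)\<close>.\<close>
  define C where "C = L powr p * (2 * 4 powr (p - 1)) * K"
  have C: "0 < C" using L(1) K by (simp add: C_def)
  have main: "T f \<in> Gamma_space R p \<phi>2 M2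
      \<and> Gamma_norm R p \<phi>2 M2 (T f) \<le> ennreal (C powr (1 / p)) * Gamma_norm R p \<phi>1 M1 f"
    if f: "f \<in> Gamma_space R p \<phi>1 M1" for f
  proof -
    \<comment> \<open>The embedding into the sum space puts \<open>f\<close> into the domain of
      \<open>T\<close>. It also makes the maximal function of \<open>f\<close> finite on
      \<open>(0,R)\<close>, since it is finite for both summands.\<close>
    have fD: "f \<in> ?D" using emb1(2) f by blast
    then obtain g h where gh: "g \<in> M_space R \<phi> M1" "h \<in> M_space R \<psi> M1" "f = (\<lambda>x. g x + h x)"
      unfolding fun_set_plus_def by auto
    have gh_meas: "g \<in> borel_measurable M1" "h \<in> borel_measurable M1" "f \<in> borel_measurable M1"
      using gh f by (auto simp: M_space_def Gamma_space_def)
    have fin: "maxrearr M1 f s < \<infinity>" if s: "s \<in> Ioo0 R" for s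
    proof -
      have M_fin: "maxrearr M1 u s < \<infinity>" if "u \<in> M_space R \<theta> M1" "quasiconcave R \<theta>" for u \<theta>
      proof -
        obtain c where "M_norm R \<theta> M1 u = ennreal c" "0 \<le> c"
          using \<open>u \<in> _\<close> by (cases "M_norm R \<theta> M1 u") (auto simp: M_space_def)
        then have "maxrearr M1 u s \<le> ennreal (c / \<theta> s)"
          by (intro maxrearr_le_if_M_norm_le[OF that(2) s]) auto
        then show ?thesis by (auto intro: le_less_trans)
      qed
      have "maxrearr M1 f s \<le> ennreal (2 * 1) * (maxrearr M1 g s + maxrearr M1 h s)"
        using s gh_meas gh(3)
        by (intro maxrearr_quasi_subadditive) (auto simp: Ioo0_def)
      also have "\<dots> < \<infinity>"
        using M_fin[OF gh(1) qc_phi] M_fin[OF gh(2) qc_psi] by (simp add: ennreal_mult_less_top)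
      finally show ?thesis .
    qed
    define w where "w = (\<lambda>s. enn2real (drearr M1 f s) * indicator {0<..} s)"
    interpret decreasing_density w
      unfolding w_def by (rule decreasing_density_drearr[OF R_pos meas1 fin])
    have F: "maxrearr M1 f s = ennreal (F s / s)" if "s \<in> Ioo0 R" for s
      unfolding w_def by (rule primitive_drearr[OF R_pos meas1 fin that])
    have Fs: "0 \<le> F s / s" if "s \<in> Ioo0 R" for s
      using that by (simp add: F_nonneg Ioo0_def)
    have "(\<integral>\<^sup>+ t\<in>Ioo0 R. ennpow (maxrearr M2 (T f) t) p * ennreal (v2 t) \<partial>lborel)
        \<le> ennreal C * (\<integral>\<^sup>+ t\<in>Ioo0 R. ennreal ((F t / t) powr p) * ennreal (v1 t) \<partial>lborel)"
      unfolding C_def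
    proof (rule weighted_inequality[OF meas qc' R_pos p less_imp_le[OF K] L(1) cond])
      \<comment> \<open>With the maximal function of \<open>T f\<close> as \<open>G\<close>, the
        required implication is \<open>L(2)\<close>, because the maximal function of
        \<open>f\<close> at \<open>s\<close> equals \<open>F s / s\<close>.\<close>
      fix t N assume t: "t \<in> Ioo0 R" and N: "0 \<le> N"
        and bound: "\<And>s. s \<in> Ioo0 R \<Longrightarrow> F s / s \<le> N * max (\<phi>' t / \<phi>' s) (\<psi>' t / \<psi>' s)"
      show "maxrearr M2 (T f) t \<le> ennreal (L * N)"
        using bound t by (intro L(2)[OF fD t N]) (auto simp: F eq intro!: ennreal_leI)
    qed
    also have "(\<integral>\<^sup>+ t\<in>Ioo0 R. ennpow (maxrearr M2 (T f) t) p * ennreal (v2 t) \<partial>lborel)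
        = (\<integral>\<^sup>+ t\<in>Ioo0 R. ennpow (maxrearr M2 (T f) t) p * ennreal (\<phi>2 t) \<partial>lborel)"
      by (intro nn_integral_cong) (auto simp: indicator_def eq)
    also have "(\<integral>\<^sup>+ t\<in>Ioo0 R. ennreal ((F t / t) powr p) * ennreal (v1 t) \<partial>lborel)
        = (\<integral>\<^sup>+ t\<in>Ioo0 R. ennpow (maxrearr M1 f t) p * ennreal (\<phi>1 t) \<partial>lborel)"
      using Fs by (intro nn_integral_cong) (auto simp: indicator_def eq F ennpow_ennreal)
    finally have le: "Gamma_norm R p \<phi>2 M2 (T f) \<le> ennreal (C powr (1 / p)) * Gamma_norm R p \<phi>1 M1 f"
      unfolding Gamma_norm_eq ennpow_cmult[OF C, symmetric] using p by (intro ennpow_mono) auto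
    also have "\<dots> < \<infinity>" using f by (simp add: Gamma_space_def ennreal_mult_less_top)
    finally have "T f \<in> Gamma_space R p \<phi>2 M2"
      using ql fD by (simp add: Gamma_space_def quasilinear_def)
    with le show ?thesis by blast
  qed
  show ?thesis
    unfolding bounded_op_def by (rule exI[of _ "C powr (1 / p)"]) (use main in auto)
qed

end
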